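(* Let $\beta\in\{1,2,4\}$, $N\ge 1$, and let $X$ be a random $N\times N$ matrix with real ($\beta=1$), complex ($\beta=2$) or quaternion ($\beta=4$) entries, whose rows $\mathbf x_1,\dots,\mathbf x_N$ are independent. Let $\Psi(x)=\frac{d}{dx}\log\Gamma(x)$ denote the digamma function. (i) (Gaussian weight) If for each $l$ the row $\mathbf x_l$ has density $(2\pi\sigma_l^2)^{-\beta N/2}e^{-|\mathbf x|^2/2\sigma_l^2}$ on $\mathbb R^{\beta N}$, with $\sigma_l>0$, then $$\Big\langle\log|\det X|\Big\rangle=\frac12\sum_{l=1}^N\Big(\log 2\sigma_l^2+\Psi\big(\beta(N-l+1)/2\big)\Big).$$ (ii) (Beta type I weight) If for each $l$ the row $\mathbf x_l$ has density $\pi^{-\beta N/2}(\beta\nu_l/2)_{\beta N/2}(1-|\mathbf x|^2)^{\beta\nu_l/2-1}$ on the unit ball of $\mathbb R^{\beta N}$, with $\nu_l>0$, then $$\Big\langle\log|\det X|\Big\rangle=\frac12\sum_{l=1}^N\Big(\Psi\big(\beta(N-l+1)/2\big)-\Psi\big(\beta(N+\nu_l)/2\big)\Big).$$ (iii) (Beta type II weight) If for each $l$ the row $\mathbf x_l$ has density $\pi^{-\beta N/2}(\omega_l/2)_{\beta N/2}(1+|\mathbf x|^2)^{-(\beta N+\omega_l)/2}$ on $\mathbb R^{\beta N}$, with $\omega_l>0$, then $$\Big\langle\log|\det X|\Big\rangle=\frac12\sum_{l=1}^N\Big(\Psi\big(\beta(N-l+1)/2\big)-\Psi\big(\beta\o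mega_l/2\big)\Big).$$
   Context: $\langle\cdot\rangle$ denotes expectation, and $(c)_s=\Gamma(c+s)/\Gamma(c)$. A row $\mathbf x=(x_1,\dots,x_N)$ with real, complex or quaternion entries is identified with a vector in $\mathbb R^{\beta N}$ (each entry has $\beta$ real components), $|x_i|^2$ is the sum of the squares of the real components of $x_i$, and $|\mathbf x|^2=\sum_i|x_i|^2$; densities are with respect to Lebesgue measure on $\mathbb R^{\beta N}$. $|\det X|:=(\det X^\dagger X)^{1/2}$. In the quaternion case $X$ is represented as a $2N\times 2N$ complex matrix whose entries are the $2\times2$ blocks $\begin{bmatrix} z&w\\-\bar w&\bar z\end{bmatrix}$, and $\det X^\dagger X$ is the quaternion determinant, i.e. the positive square root of the ordinary determinant of the $2N\times2N$ complex matrix $X^\dagger X$.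
   Formalization: In (iii) the last term is Ψ(ω_l/2) instead of the printed Ψ(βω_l/2), which is false for β=2,4 with the given density (N=1, β=2, ω_1=2 gives expectation 0, not −1/2); for β=1 they agree. *)

theory Defs
  imports
    "HOL-Probability.Probability"
    "Jordan_Normal_Form.Schur_Decomposition"
begin

text \<open>
  A row with \<open>N\<close> entries, each having \<open>\<beta>\<close> real components, is a function \<open>y :: nat \<Rightarrow> real\<close> on
  \<open>{..<\<beta> * N}\<close>; component \<open>c\<close> of entry \<open>j\<close> (both counted from 0) is \<open>y (\<beta> * j + c)\<close>.
  A family of rows is a function \<open>Y :: nat \<Rightarrow> nat \<Rightarrow> real\<close>, whose rows are numbered \<open>1, \<dots>, N\<close>,
  whereas matrix indices start from 0.
\<close>

definition lebesgue_power :: "nat \<Rightarrow> (nat \<Rightarrow> real) measure" where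
  "lebesgue_power n = (\<Pi>\<^sub>M k\<in>{..<n}. (lborel :: real measure))"

definition sq_norm_row :: "nat \<Rightarrow> (nat \<Rightarrow> real) \<Rightarrow> real" where
  "sq_norm_row n y = (\<Sum>k<n. (y k)\<^sup>2)"

definition real_matrix :: "nat \<Rightarrow> (nat \<Rightarrow> nat \<Rightarrow> real) \<Rightarrow> real mat" where
  "real_matrix N Y = Matrix.mat N N (\<lambda>(i, j). Y (Suc i) j)"

definition complex_matrix :: "nat \<Rightarrow> (nat \<Rightarrow> nat \<Rightarrow> real) \<Rightarrow> complex mat" where
  "complex_matrix N Y =
     Matrix.mat N N (\<lambda>(i, j). Complex (Y (Suc i) (2 * j)) (Y (Suc i) (2 * j + 1)))"

definition quaternion_block :: "complex \<Rightarrow> complex \<Rightarrow> nat \<Rightarrow> nat \<Rightarrow> complex" where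
  "quaternion_block z w a b =
     (if a = 0 then (if b = 0 then z else w) else (if b = 0 then - cnj w else cnj z))"

definition quaternion_matrix :: "nat \<Rightarrow> (nat \<Rightarrow> nat \<Rightarrow> real) \<Rightarrow> complex mat" where
  "quaternion_matrix N Y =
     Matrix.mat (2 * N) (2 * N) (\<lambda>(i, j).
       let y = Y (Suc (i div 2)); k = 4 * (j div 2)
       in quaternion_block (Complex (y k) (y (k + 1))) (Complex (y (k + 2)) (y (k + 3)))
            (i mod 2) (j mod 2))"

definition gram_det :: "'a :: conjugatable_field mat \<Rightarrow> 'a" where
  "gram_det A = Determinant.det (mat_adjoint A * A)"

text \<open>
  \<open>\<bar>det X\<bar> = (det X\<^sup>\<dagger> X)\<^bsup>1/2\<^esup>\<close>. For quaternions the determinant of \<open>X\<^sup>\<dagger> X\<close> is itself the positive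
  square root of the ordinary determinant of the \<open>2N \<times> 2N\<close> complex matrix, hence the double root.
  Complex Gram determinants are real and nonnegative, so \<open>Re\<close> loses nothing.
  Only \<open>\<beta> = 1, 2, 4\<close> are meaningful.
\<close>

definition abs_det :: "nat \<Rightarrow> nat \<Rightarrow> (nat \<Rightarrow> nat \<Rightarrow> real) \<Rightarrow> real" where
  "abs_det \<beta> N Y =
     (if \<beta> = 1 then sqrt (gram_det (real_matrix N Y))
      else if \<beta> = 2 then sqrt (Re (gram_det (complex_matrix N Y)))
      else sqrt (sqrt (Re (gram_det (quaternion_matrix N Y)))))"

text \<open>The generalised Pochhammer symbol \<open>(c)\<^sub>s\<close>, for real \<open>s\<close>.\<close>

definition gen_pochhammer :: "real \<Rightarrow> real \<Rightarrow> real" where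
  "gen_pochhammer c s = Gamma (c + s) / Gamma c"

definition gaussian_density :: "nat \<Rightarrow> nat \<Rightarrow> real \<Rightarrow> (nat \<Rightarrow> real) \<Rightarrow> real" where
  "gaussian_density \<beta> N \<sigma> y =
     (2 * pi * \<sigma>\<^sup>2) powr (- (real \<beta> * real N / 2)) *
     exp (- sq_norm_row (\<beta> * N) y / (2 * \<sigma>\<^sup>2))"

definition beta1_density :: "nat \<Rightarrow> nat \<Rightarrow> real \<Rightarrow> (nat \<Rightarrow> real) \<Rightarrow> real" where
  "beta1_density \<beta> N \<nu> y =
     (if sq_norm_row (\<beta> * N) y < 1 then
        pi powr (- (real \<beta> * real N / 2)) *
        gen_pochhammer (real \<beta> * \<nu> / 2) (real \<beta> * real N / 2) *
        (1 - sq_norm_row (\<beta> * N) y) powr (real \<beta> * \<nu> / 2 - 1)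
      else 0)"

text \<open>
  Unlike \<open>\<nu>\<close> above, the parameter \<open>\<omega>\<close> is not multiplied by \<open>\<beta>\<close>: under this density the squared
  norm of a row is beta prime distributed with parameters \<open>\<beta> N / 2\<close> and \<open>\<omega> / 2\<close>.
\<close>

definition beta2_density :: "nat \<Rightarrow> nat \<Rightarrow> real \<Rightarrow> (nat \<Rightarrow> real) \<Rightarrow> real" where
  "beta2_density \<beta> N \<omega> y =
     pi powr (- (real \<beta> * real N / 2)) *
     gen_pochhammer (\<omega> / 2) (real \<beta> * real N / 2) *
     (1 + sq_norm_row (\<beta> * N) y) powr (- (real \<beta> * real N + \<omega>) / 2)"

end

theory Submission
  imports Defs "HOL-Real_Asymp.Real_Asymp"
begin

text \<open>
  If the rows are independent and their laws are invariant under orthogonal maps, the first row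
  \<open>y\<close> can be rotated, by Householder reflections that respect the complex or quaternionic
  structure, into its first entry. This leaves \<open>\<bar>y\<bar>\<close> times the determinant of the other rows
  with their first entry removed, and those laws are again invariant. By induction
  \<open>\<langle>\<bar>det X\<bar>\<^bsup>2p\<^esup>\<rangle>\<close> is the product over \<open>l\<close> of the \<open>p\<close>-th moments of the squared norm of the
  last \<open>N - l + 1\<close> entries of row \<open>l\<close>. For the three radial densities these moments are quotients
  of Gamma functions, and the derivative of the product at \<open>p = 0\<close> is \<open>2 \<langle>log \<bar>det X\<bar>\<rangle>\<close>.
\<close>

section \<open>Beta and Gamma integrals\<close>

text \<open>Logarithms are not integrated directly. The singularity at det X = 0 is controlled by
  moments of small negative exponent, finite because even the last row keeps \<open>\<beta>\<close>
  real components in its factor. Integrals of nonnegative powers factor by Tonelli without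
  integrability hypotheses; integrability of the logarithm then follows from moments of both signs.
  Invariance is only used under real reflections: each step composes one, two or four of them for
  \<open>\<beta>\<close> = 1, 2, 4, chosen from the first row alone. The obstacle is the
  quaternionic case, where the rows of the complex matrix come in pairs linked by an antilinear map;
  the reflections must commute with it for the remaining rows to keep that form. In the third case
  the given density makes the squared norm beta prime with second parameter
  \<open>\<omega> / 2\<close>. The digamma term is therefore taken at \<open>\<omega> / 2\<close>,
  not at \<open>\<beta> * \<omega> / 2\<close> as in the English statement; the two formulas agree
  only for \<open>\<beta> = 1\<close>.\<close>

lemma nn_integral_Beta:
  fixes a b :: real
  assumes "a > 0" "b > 0"
  shows "(\<integral>\<^sup>+t\<in>{0<..<1}. ennreal (t powr (a - 1) * (1 - t) powr (b - 1)) \<partial>lborel) =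
    ennreal (Beta a b)"
proof -
  have "((\<lambda>t. t powr (a - 1) * (1 - t) powr (b - 1)) has_integral Beta a b) {0<..<1}"
    using has_integral_Beta_real[OF assms] by (simp add: has_integral_Icc_iff_Ioo)
  from nn_integral_has_integral_lebesgue[OF _ this] show ?thesis
    by (simp add: ennreal_mult' ennreal_indicator mult_ac)
qed

lemma nn_integral_Gamma:
  fixes a c :: real
  assumes "a > 0" "c > 0"
  shows "(\<integral>\<^sup>+t\<in>{0<..}. ennreal (t powr (a - 1) * exp (- t / c)) \<partial>lborel) =
    ennreal (c powr a * Gamma a)"
proof -
  have *: "(\<integral>\<^sup>+t\<in>{0<..}. ennreal (t powr (a - 1) * exp (- t)) \<partial>lborel) = ennreal (Gamma a)"
    unfolding Gamma_conv_nn_integral_real[OF assms(1)]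
    by (intro nn_integral_cong) (auto simp: indicator_def exp_minus field_simps)
  have "(\<integral>\<^sup>+t\<in>{0<..}. ennreal (t powr (a - 1) * exp (- t / c)) \<partial>lborel) =
      \<bar>c\<bar> * (\<integral>\<^sup>+t. ennreal ((0 + c * t) powr (a - 1) * exp (- (0 + c * t) / c)) *
        indicator {0<..} (0 + c * t) \<partial>lborel)"
    using assms by (intro nn_integral_real_affine) auto
  also have "(\<integral>\<^sup>+t. ennreal ((0 + c * t) powr (a - 1) * exp (- (0 + c * t) / c)) *
        indicator {0<..} (0 + c * t) \<partial>lborel) =
      (\<integral>\<^sup>+t. ennreal (c powr (a - 1)) * (ennreal (t powr (a - 1) * exp (- t)) * indicator {0<..} t) \<partial>lborel)"
    using assms
    by (intro nn_integral_cong)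
      (auto simp: indicator_def powr_mult zero_less_mult_iff ennreal_mult' mult_ac)
  also have "\<dots> = ennreal (c powr (a - 1)) * ennreal (Gamma a)"
    by (subst nn_integral_cmult) (auto simp: *)
  also have "\<bar>c\<bar> * \<dots> = ennreal (c powr a * Gamma a)"
    using assms Gamma_real_pos[of a]
    by (simp add: ennreal_mult[symmetric] powr_diff)
  finally show ?thesis .
qed

text \<open>Put \<open>t = u + v\<close>, exchange the integrals and scale \<open>v\<close> by
  \<open>t\<close>: the power densities convolve to a multiple of \<open>t powr (r + q - 1)\<close>.
  This later joins the squared norms of the dropped and the kept coordinates of a row.\<close>

lemma nn_integral_Beta_convolution:
  fixes r q :: real and h :: "real \<Rightarrow> ennreal"
  assumes "r > 0" "q > 0" and [measurable]: "h \<in> borel_measurable borel"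
  shows "(\<integral>\<^sup>+v\<in>{0<..}. ennreal (v powr (q - 1)) *
      (\<integral>\<^sup>+u\<in>{0<..}. ennreal (u powr (r - 1)) * h (u + v) \<partial>lborel) \<partial>lborel) =
    ennreal (Beta r q) * (\<integral>\<^sup>+t\<in>{0<..}. ennreal (t powr (r + q - 1)) * h t \<partial>lborel)"
    (is "?L = _")
proof -
  define K where "K = (\<lambda>t v. ennreal (v powr (q - 1)) * indicator {0<..} v *
    (ennreal ((t - v) powr (r - 1)) * indicator {v<..} t) :: ennreal)"
  \<comment> \<open>The endpoint of \<open>{v<..}\<close> moves; written as a conditional, the
    kernel is measurable in both arguments jointly.\<close>
  have ind: "indicator {v<..} t = (if v < t then 1 else 0 :: ennreal)" for v t :: real
    by (simp add: indicator_def)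
  have [measurable]: "(\<lambda>x. K (fst x) (snd x)) \<in> borel_measurable (borel \<Otimes>\<^sub>M borel)"
    unfolding K_def ind by measurable
  have [measurable]: "K t \<in> borel_measurable borel" for t
    unfolding K_def ind by measurable
  have shift: "(\<integral>\<^sup>+u\<in>{0<..}. ennreal (u powr (r - 1)) * h (u + v) \<partial>lborel) =
      (\<integral>\<^sup>+t\<in>{v<..}. ennreal ((t - v) powr (r - 1)) * h t \<partial>lborel)" for v
    by (subst nn_integral_real_affine[where c = 1 and t = "- v"])
      (auto intro!: nn_integral_cong simp: indicator_def)
  have "?L = (\<integral>\<^sup>+v. \<integral>\<^sup>+t. K t v * h t \<partial>lborel \<partial>lborel)"
    unfolding shift K_def
    by (subst nn_integral_cmult[symmetric], simp_all add: mult_ac)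
      (intro nn_integral_cong, auto intro!: nn_integral_cong simp: indicator_def mult_ac
        nn_integral_cmult[symmetric])
  also have "\<dots> = (\<integral>\<^sup>+t. \<integral>\<^sup>+v. K t v * h t \<partial>lborel \<partial>lborel)"
    by (rule lborel_pair.Fubini'[where f = "\<lambda>t v. K t v * h t"]) (simp add: case_prod_beta)
  also have "\<dots> = (\<integral>\<^sup>+t. ennreal (Beta r q) * (ennreal (t powr (r + q - 1)) * h t * indicator {0<..} t) \<partial>lborel)"
  proof (rule nn_integral_cong)
    fix t :: real
    have "(\<integral>\<^sup>+v. K t v \<partial>lborel) = ennreal (Beta r q) * ennreal (t powr (r + q - 1)) * indicator {0<..} t"
    proof (cases "t > 0")
      case True
      have "(\<integral>\<^sup>+v. K t v \<partial>lborel) = \<bar>t\<bar> * (\<integral>\<^sup>+v. K t (0 + t * v) \<partial>lborel)"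
        using True by (intro nn_integral_real_affine) measurable
      also have "(\<integral>\<^sup>+v. K t (0 + t * v) \<partial>lborel) =
          (\<integral>\<^sup>+v. ennreal (t powr (r - 1) * t powr (q - 1)) *
            (ennreal (v powr (q - 1) * (1 - v) powr (r - 1)) * indicator {0<..<1} v) \<partial>lborel)"
      proof (rule nn_integral_cong)
        fix v :: real
        have "(t - t * v) powr (r - 1) = t powr (r - 1) * (1 - v) powr (r - 1)" if "v < 1"
          using True that by (simp add: powr_mult[symmetric] right_diff_distrib)
        then show "K t (0 + t * v) = ennreal (t powr (r - 1) * t powr (q - 1)) *
            (ennreal (v powr (q - 1) * (1 - v) powr (r - 1)) * indicator {0<..<1} v)"
          using True
          by (auto simp: K_def indicator_def powr_mult zero_less_mult_iff ennreal_mult[symmetric] mult_ac)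
      qed
      also have "\<dots> = ennreal (t powr (r - 1) * t powr (q - 1)) * ennreal (Beta q r)"
        by (subst nn_integral_cmult) (simp_all add: nn_integral_Beta assms)
      also have "\<bar>t\<bar> * \<dots> = ennreal (Beta r q) * ennreal (t powr (r + q - 1))"
      proof -
        have "t * (t powr (r - 1) * t powr (q - 1)) = t powr (r + q - 1)"
          using True by (simp add: powr_diff powr_add)
        then have "ennreal t * ennreal (t powr (r - 1) * t powr (q - 1)) = ennreal (t powr (r + q - 1))"
          using True by (metis ennreal_mult less_imp_le powr_ge_zero mult_nonneg_nonneg)
        then show ?thesis
          using True by (simp only: Beta_commute[of q r] mult.assoc[symmetric] abs_of_pos)
            (simp only: mult.commute)
      qed
      finally show ?thesis using True by simp
    next
      case False
      then have "K t v = 0" for v by (auto simp: K_def indicator_def)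
      then show ?thesis using False by simp
    qed
    then show "(\<integral>\<^sup>+v. K t v * h t \<partial>lborel) =
        ennreal (Beta r q) * (ennreal (t powr (r + q - 1)) * h t * indicator {0<..} t)"
      by (subst nn_integral_multc, measurable) (simp add: mult_ac)
  qed
  also have "\<dots> = ennreal (Beta r q) * (\<integral>\<^sup>+t\<in>{0<..}. ennreal (t powr (r + q - 1)) * h t \<partial>lborel)"
    by (rule nn_integral_cmult) simp
  finally show ?thesis .
qed

text \<open>Writing the power of \<open>1 + t\<close> as a Gamma integral avoids the substitution \<open>t / (1 + t)\<close>.\<close>

lemma nn_integral_Beta_prime:
  fixes a b :: real
  assumes "a > 0" "b > 0"
  shows "(\<integral>\<^sup>+t\<in>{0<..}. ennreal (t powr (a - 1) * (1 + t) powr (- (a + b))) \<partial>lborel) =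
    ennreal (Beta a b)"
proof -
  let ?G = "ennreal (Gamma (a + b))"
  have pos: "Gamma (a + b) > 0" "Gamma a > 0" "Gamma b > 0"
    using assms by (auto intro: Gamma_real_pos)
  have 1: "ennreal (t powr (a - 1) * (1 + t) powr (- (a + b))) * ?G * indicator {0<..} t =
      (\<integral>\<^sup>+r. ennreal (t powr (a - 1)) * indicator {0<..} t *
        (ennreal (r powr (a + b - 1) * exp (- r * (1 + t))) * indicator {0<..} r) \<partial>lborel)" for t
  proof (cases "t > 0")
    case True
    have "(\<integral>\<^sup>+r\<in>{0<..}. ennreal (r powr (a + b - 1) * exp (- r * (1 + t))) \<partial>lborel) =
        ennreal ((1 / (1 + t)) powr (a + b) * Gamma (a + b))"
      using nn_integral_Gamma[of "a + b" "1 / (1 + t)"] assms True by simp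
    also have "(1 / (1 + t)) powr (a + b) = (1 + t) powr (- (a + b))"
      unfolding powr_minus_divide using True by (simp add: powr_divide)
    finally have I: "(\<integral>\<^sup>+r\<in>{0<..}. ennreal (r powr (a + b - 1) * exp (- r * (1 + t))) \<partial>lborel) =
        ennreal ((1 + t) powr (- (a + b))) * ?G"
      using pos by (metis ennreal_mult less_imp_le powr_ge_zero)
    show ?thesis
      using True by (subst nn_integral_cmult, measurable)
        (simp only: I, simp only: ennreal_mult powr_ge_zero mult_1_right mult.assoc indicator_simps greaterThan_iff)
  qed simp
  have "(\<integral>\<^sup>+t\<in>{0<..}. ennreal (t powr (a - 1) * (1 + t) powr (- (a + b))) \<partial>lborel) * ?G =
      (\<integral>\<^sup>+t. ennreal (t powr (a - 1) * (1 + t) powr (- (a + b))) * ?G * indicator {0<..} t \<partial>lborel)"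
    by (subst nn_integral_multc[symmetric]) (auto simp: mult_ac)
  also have "\<dots> = (\<integral>\<^sup>+t. \<integral>\<^sup>+r. ennreal (t powr (a - 1)) * indicator {0<..} t *
        (ennreal (r powr (a + b - 1) * exp (- r * (1 + t))) * indicator {0<..} r) \<partial>lborel \<partial>lborel)"
    unfolding 1 ..
  also have "\<dots> = (\<integral>\<^sup>+r. \<integral>\<^sup>+t. ennreal (t powr (a - 1)) * indicator {0<..} t *
        (ennreal (r powr (a + b - 1) * exp (- r * (1 + t))) * indicator {0<..} r) \<partial>lborel \<partial>lborel)"
    by (rule lborel_pair.Fubini') (simp add: case_prod_beta)
  also have "\<dots> = (\<integral>\<^sup>+r. ennreal (Gamma a) * (ennreal (r powr (b - 1) * exp (- r / 1)) * indicator {0<..} r) \<partial>lborel)"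
  proof (rule nn_integral_cong)
    fix r :: real
    show "(\<integral>\<^sup>+t. ennreal (t powr (a - 1)) * indicator {0<..} t *
        (ennreal (r powr (a + b - 1) * exp (- r * (1 + t))) * indicator {0<..} r) \<partial>lborel) =
        ennreal (Gamma a) * (ennreal (r powr (b - 1) * exp (- r / 1)) * indicator {0<..} r)"
    proof (cases "r > 0")
      case True
      have "(\<integral>\<^sup>+t. ennreal (t powr (a - 1)) * indicator {0<..} t *
          (ennreal (r powr (a + b - 1) * exp (- r * (1 + t))) * indicator {0<..} r) \<partial>lborel) =
          (\<integral>\<^sup>+t. ennreal (r powr (a + b - 1) * exp (- r)) *
            (ennreal (t powr (a - 1) * exp (- t / (1 / r))) * indicator {0<..} t) \<partial>lborel)"
        using True
        by (intro nn_integral_cong)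
          (auto simp: indicator_def ennreal_mult[symmetric] exp_add[symmetric] algebra_simps)
      also have "\<dots> = ennreal (r powr (a + b - 1) * exp (- r)) * ennreal ((1 / r) powr a * Gamma a)"
        using True assms by (subst nn_integral_cmult, measurable) (subst nn_integral_Gamma, auto)
      also have "\<dots> = ennreal (Gamma a) * ennreal (r powr (b - 1) * exp (- r / 1))"
      proof -
        have "r powr (a + b - 1) * (1 / r) powr a = r powr (b - 1)"
          using True by (simp add: powr_divide powr_diff powr_add)
        then show ?thesis
          using True pos
          by (simp add: ennreal_mult[symmetric] mult.commute[of "Gamma a"] exp_minus mult.assoc[symmetric])
      qed
      finally show ?thesis using True by simp
    qed simp
  qed
  also have "\<dots> = ennreal (Gamma a) * ennreal (Gamma b)"
    using assms by (subst nn_integral_cmult, measurable) (subst nn_integral_Gamma, auto)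
  also have "\<dots> = ennreal (Beta a b) * ?G"
    using pos by (simp add: Beta_def ennreal_mult[symmetric])
  finally show ?thesis
    using pos by (simp add: mult.commute[of _ ?G] ennreal_mult_cancel_left)
qed

text \<open>Replaces polar coordinates: the known volume of balls determines the image of Lebesgue
  measure under the squared norm on all half-lines, and these generate the Borel sets. The constant
  comes from differentiating the ball volume
  \<open>pi powr \<alpha> / Gamma (\<alpha> + 1) * a powr \<alpha>\<close> in \<open>a\<close>,
  where \<open>\<alpha>\<close> is half the dimension.\<close>

lemma nn_integral_sq_norm:
  fixes A :: "'i set" and g :: "real \<Rightarrow> ennreal"
  assumes A: "finite A" "card A > 0" and [measurable]: "g \<in> borel_measurable borel"
  shows "(\<integral>\<^sup>+y. g (\<Sum>i\<in>A. (y i)\<^sup>2) \<partial>(\<Pi>\<^sub>M i\<in>A. lborel)) =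
    ennreal (pi powr (card A / 2) / Gamma (card A / 2)) *
      (\<integral>\<^sup>+t\<in>{0<..}. ennreal (t powr (card A / 2 - 1)) * g t \<partial>lborel)"
proof -
  let ?P = "\<Pi>\<^sub>M i\<in>A. (lborel :: real measure)"
  define q where "q = (\<lambda>y :: 'i \<Rightarrow> real. \<Sum>i\<in>A. (y i)\<^sup>2)"
  define c where "c = pi powr (card A / 2) / Gamma (card A / 2)"
  define \<alpha> where "\<alpha> = real (card A) / 2"
  have \<alpha>: "\<alpha> > 0" using A by (simp add: \<alpha>_def)
  have c: "c > 0" using \<alpha> by (simp add: c_def \<alpha>_def Gamma_real_pos)
  define D where "D = density lborel (\<lambda>t. ennreal c * (ennreal (t powr (\<alpha> - 1)) * indicator {0<..} t))"
  interpret product_sigma_finite "\<lambda>_ :: 'i. lborel :: real measure" ..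
  have q[measurable]: "q \<in> borel_measurable ?P"
    unfolding q_def by measurable
  have P: "emeasure (distr ?P borel q) {..a} = ennreal (c * (max a 0) powr \<alpha> / \<alpha>)" for a
  proof (cases "a > 0")
    case True
    have "emeasure (distr ?P borel q) {..a} = emeasure ?P ({f. sqrt (\<Sum>i\<in>A. (f i)\<^sup>2) \<le> sqrt a} \<inter> space ?P)"
      by (subst emeasure_distr) (auto simp: q_def intro!: arg_cong2[where f = emeasure])
    also have "\<dots> = ennreal (unit_ball_vol (real (card A)) * sqrt a ^ card A)"
      using A True by (intro emeasure_cball_aux) auto
    also have "unit_ball_vol (real (card A)) * sqrt a ^ card A = c * (max a 0) powr \<alpha> / \<alpha>"
    proof -
      have "sqrt a ^ card A = a powr \<alpha>"
        using True by (simp add: powr_half_sqrt[symmetric] powr_realpow[symmetric] powr_powr \<alpha>_def)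
      moreover have "Gamma (\<alpha> + 1) = \<alpha> * Gamma \<alpha>"
        using \<alpha> by (simp add: Gamma_plus1 nonpos_Ints_def)
      ultimately show ?thesis
        using True by (simp add: unit_ball_vol_def c_def \<alpha>_def[symmetric])
    qed
    finally show ?thesis .
  next
    case False
    \<comment> \<open>For \<open>a \<le> 0\<close> the preimage contains at most the origin, a null
      set because \<open>A\<close> is nonempty.\<close>
    have "emeasure (distr ?P borel q) {..a} = emeasure ?P (q -` {..a} \<inter> space ?P)"
      by (rule emeasure_distr) auto
    also have "\<dots> \<le> emeasure ?P (\<Pi>\<^sub>E i\<in>A. {0})"
    proof (rule emeasure_mono)
      show "q -` {..a} \<inter> space ?P \<subseteq> (\<Pi>\<^sub>E i\<in>A. {0})"
      proof
        fix y assume y: "y \<in> q -` {..a} \<inter> space ?P"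
        then have "q y \<le> 0" using False by auto
        then have "q y = 0" by (simp add: q_def antisym sum_nonneg)
        then have "\<forall>i\<in>A. y i = 0" using A by (simp add: q_def sum_nonneg_eq_0_iff)
        with y show "y \<in> (\<Pi>\<^sub>E i\<in>A. {0})" by (auto simp: space_PiM PiE_def extensional_def restrict_def fun_eq_iff)
      qed
      show "(\<Pi>\<^sub>E i\<in>A. {0}) \<in> sets ?P"
        by (rule sets_PiM_I_finite) (use A in auto)
    qed
    also have "\<dots> = 0"
      using A by (subst emeasure_PiM) (auto simp: card_gt_0_iff)
    finally show ?thesis using False \<alpha> by simp
  qed
  have D: "emeasure D {..a} = ennreal (c * (max a 0) powr \<alpha> / \<alpha>)" for a
  proof -
    \<comment> \<open>The endpoint \<open>0\<close> may be added pointwise, because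
      \<open>0 powr (\<alpha> - 1)\<close> is \<open>0\<close>.\<close>
    have "emeasure D {..a} = (\<integral>\<^sup>+t. ennreal c * (ennreal (t powr (\<alpha> - 1)) * indicator {0..max a 0} t) \<partial>lborel)"
      unfolding D_def
      by (subst emeasure_density) (auto intro!: nn_integral_cong simp: indicator_def)
    also have "\<dots> = ennreal c * (\<integral>\<^sup>+t. ennreal (indicator {0..max a 0} t * t powr (\<alpha> - 1)) \<partial>lborel)"
      by (subst nn_integral_cmult)
        (auto intro!: nn_integral_cong arg_cong[where f = "\<lambda>z. ennreal c * z"] split: split_indicator)
    also have "(\<integral>\<^sup>+t. ennreal (indicator {0..max a 0} t * t powr (\<alpha> - 1)) \<partial>lborel) =
        ennreal ((max a 0) powr (\<alpha> - 1 + 1) / (\<alpha> - 1 + 1))"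
      using \<alpha> by (intro nn_integral_has_integral_lebesgue has_integral_powr_from_0) auto
    finally show ?thesis using c \<alpha> by (simp add: ennreal_mult[symmetric])
  qed
  have eq: "distr ?P borel q = D"
  proof (rule measure_eqI_generator_eq[where E = "range atMost" and \<Omega> = UNIV and A = "\<lambda>i. {..real i}"])
    show "Int_stable (range (atMost :: real \<Rightarrow> _))"
      by (auto simp: Int_stable_def)
    show "sets (distr ?P borel q) = sigma_sets UNIV (range atMost)"
      by (simp add: borel_eq_atMost full_SetCompr_eq sets_measure_of)
    show "sets D = sigma_sets UNIV (range atMost)"
      by (simp add: D_def borel_eq_atMost full_SetCompr_eq sets_measure_of)
    show "(\<Union>i. {..real i}) = UNIV"
      by (auto intro: real_arch_simple)
    show "emeasure (distr ?P borel q) {..real i} \<noteq> \<infinity>" for i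
      unfolding P by simp
  qed (auto simp: P D)
  have "(\<integral>\<^sup>+y. g (q y) \<partial>?P) = integral\<^sup>N (distr ?P borel q) g"
    by (simp add: nn_integral_distr)
  also have "\<dots> = (\<integral>\<^sup>+t. ennreal c * (ennreal (t powr (\<alpha> - 1)) * indicator {0<..} t) * g t \<partial>lborel)"
    unfolding eq D_def by (simp add: nn_integral_density)
  also have "\<dots> = ennreal c * (\<integral>\<^sup>+t\<in>{0<..}. ennreal (t powr (\<alpha> - 1)) * g t \<partial>lborel)"
    by (subst nn_integral_cmult[symmetric]) (auto simp: mult_ac)
  finally show ?thesis by (simp add: q_def c_def \<alpha>_def)
qed

section \<open>Moments of radial densities\<close>

lemma ennreal_mult3:
  assumes "0 \<le> a" "0 \<le> b" "0 \<le> c"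
  shows "ennreal a * (ennreal b * ennreal c) = ennreal (a * (b * c))"
  using assms by (simp add: ennreal_mult)

text \<open>The first \<open>d\<close> and the last \<open>n - d\<close> coordinates have squared
  norms with power densities. The factor with exponent \<open>p\<close> only shifts the exponent of
  the second density, so \<open>nn_integral_Beta_convolution\<close> recombines both into one
  integral against \<open>h\<close>.\<close>

lemma nn_integral_radial_tail:
  fixes h :: "real \<Rightarrow> ennreal" and p :: real
  assumes "d < n" and p: "p > - (real (n - d) / 2)" and [measurable]: "h \<in> borel_measurable borel"
  shows "(\<integral>\<^sup>+y. ennreal ((\<Sum>k=d..<n. (y k)\<^sup>2) powr p) * h (sq_norm_row n y) \<partial>lebesgue_power n) =
    ennreal (pi powr (n / 2) * Gamma (real (n - d) / 2 + p) / (Gamma (real (n - d) / 2) * Gamma (n / 2 + p))) *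
    (\<integral>\<^sup>+t\<in>{0<..}. ennreal (t powr (n / 2 + p - 1)) * h t \<partial>lborel)"
proof -
  interpret product_sigma_finite "\<lambda>_ :: nat. lborel :: real measure" ..
  define m where "m = n - d"
  have m: "m > 0" "p > - (m / 2)" using assms by (auto simp: m_def)
  have n: "real n = real d + real m" using assms by (simp add: m_def)
  have tail: "(\<integral>\<^sup>+b. ennreal ((\<Sum>k=d..<n. (b k)\<^sup>2) powr p) * h (c + (\<Sum>k=d..<n. (b k)\<^sup>2)) \<partial>(\<Pi>\<^sub>M k\<in>{d..<n}. lborel)) =
      ennreal (pi powr (m / 2) / Gamma (m / 2)) *
        (\<integral>\<^sup>+u\<in>{0<..}. ennreal (u powr (m / 2 + p - 1)) * h (u + c) \<partial>lborel)" for c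
  proof -
    have "ennreal (u powr (m / 2 - 1)) * (ennreal (u powr p) * h (c + u)) * indicator {0<..} u =
        ennreal (u powr (m / 2 + p - 1)) * h (u + c) * indicator {0<..} u" for u
    proof (cases "u > 0")
      case True
      then have "u powr (m / 2 - 1) * u powr p = u powr (m / 2 + p - 1)"
        by (simp add: powr_add powr_diff)
      then have "ennreal (u powr (m / 2 - 1)) * ennreal (u powr p) = ennreal (u powr (m / 2 + p - 1))"
        by (metis ennreal_mult powr_ge_zero)
      then show ?thesis by (simp add: mult.assoc[symmetric] add.commute)
    qed simp
    then show ?thesis
      using m nn_integral_sq_norm[of "{d..<n}" "\<lambda>u. ennreal (u powr p) * h (c + u)"]
      by (simp add: m_def)
  qed
  show ?thesis
  \<comment> \<open>For \<open>d = 0\<close> the first block is empty and its squared norm has no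
    density, so the convolution is bypassed.\<close>
  proof (cases "d = 0")
    case True
    have pos: "Gamma (m / 2 + p) > 0" "Gamma (m / 2) > 0"
      using m by (auto intro!: Gamma_real_pos)
    show ?thesis
      using tail[of 0] True pos
      by (simp add: lebesgue_power_def sq_norm_row_def lessThan_atLeast0 m_def[symmetric] n)
  next
    case False
    let ?g = "\<lambda>y. ennreal ((\<Sum>k=d..<n. (y k)\<^sup>2) powr p) * h (\<Sum>k<n. (y k)\<^sup>2)"
    have un: "{..<n} = {..<d} \<union> {d..<n}" using assms by auto
    have [measurable]: "?g \<in> borel_measurable (\<Pi>\<^sub>M k\<in>{..<d} \<union> {d..<n}. lborel)"
      unfolding un[symmetric] by measurable
    have split: "(\<Sum>k<n. f k) = (\<Sum>k<d. f k) + (\<Sum>k=d..<n. f k)" for f :: "nat \<Rightarrow> real"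
      unfolding un by (rule sum.union_disjoint) auto
    have "(\<integral>\<^sup>+y. ?g y \<partial>(\<Pi>\<^sub>M k\<in>{..<n}. lborel)) =
        (\<integral>\<^sup>+a. \<integral>\<^sup>+b. ?g (merge {..<d} {d..<n} (a, b)) \<partial>(\<Pi>\<^sub>M k\<in>{d..<n}. lborel) \<partial>(\<Pi>\<^sub>M k\<in>{..<d}. lborel))"
      unfolding un by (rule product_nn_integral_fold) (auto simp flip: un)
    also have "\<dots> = (\<integral>\<^sup>+a. \<integral>\<^sup>+b. ennreal ((\<Sum>k=d..<n. (b k)\<^sup>2) powr p) *
        h ((\<Sum>k<d. (a k)\<^sup>2) + (\<Sum>k=d..<n. (b k)\<^sup>2)) \<partial>(\<Pi>\<^sub>M k\<in>{d..<n}. lborel) \<partial>(\<Pi>\<^sub>M k\<in>{..<d}. lborel))"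
      unfolding split by (simp add: merge_def)
    also have "\<dots> = (\<integral>\<^sup>+a. ennreal (pi powr (m / 2) / Gamma (m / 2)) *
        (\<integral>\<^sup>+u\<in>{0<..}. ennreal (u powr (m / 2 + p - 1)) * h (u + (\<Sum>k<d. (a k)\<^sup>2)) \<partial>lborel) \<partial>(\<Pi>\<^sub>M k\<in>{..<d}. lborel))"
      unfolding tail ..
    also have "\<dots> = ennreal (pi powr (d / 2) / Gamma (d / 2)) *
      (\<integral>\<^sup>+v\<in>{0<..}. ennreal (v powr (d / 2 - 1)) * (ennreal (pi powr (m / 2) / Gamma (m / 2)) *
        (\<integral>\<^sup>+u\<in>{0<..}. ennreal (u powr (m / 2 + p - 1)) * h (u + v) \<partial>lborel)) \<partial>lborel)"
      using False nn_integral_sq_norm[of "{..<d}" "\<lambda>v. ennreal (pi powr (m / 2) / Gamma (m / 2)) *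
        (\<integral>\<^sup>+u\<in>{0<..}. ennreal (u powr (m / 2 + p - 1)) * h (u + v) \<partial>lborel)"]
      by simp
    also have "\<dots> = ennreal (pi powr (d / 2) / Gamma (d / 2)) * (ennreal (pi powr (m / 2) / Gamma (m / 2)) *
      (\<integral>\<^sup>+v\<in>{0<..}. ennreal (v powr (d / 2 - 1)) *
        (\<integral>\<^sup>+u\<in>{0<..}. ennreal (u powr (m / 2 + p - 1)) * h (u + v) \<partial>lborel) \<partial>lborel))"
      by (subst nn_integral_cmult[symmetric]) (auto simp: ac_simps)
    also have "\<dots> = ennreal (pi powr (d / 2) / Gamma (d / 2)) * (ennreal (pi powr (m / 2) / Gamma (m / 2)) *
      (ennreal (Beta (m / 2 + p) (d / 2)) *
        (\<integral>\<^sup>+t\<in>{0<..}. ennreal (t powr (n / 2 + p - 1)) * h t \<partial>lborel)))"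
    proof -
      have "real n / 2 + p - 1 = real m / 2 + p + real d / 2 - 1" by (simp add: n field_simps)
      then show ?thesis
        using m False by (subst nn_integral_Beta_convolution) (simp_all only:, auto)
    qed
    also have "\<dots> = ennreal (pi powr (d / 2) / Gamma (d / 2) * (pi powr (m / 2) / Gamma (m / 2) *
      Beta (m / 2 + p) (d / 2))) *
        (\<integral>\<^sup>+t\<in>{0<..}. ennreal (t powr (n / 2 + p - 1)) * h t \<partial>lborel)"
    proof -
      have "Gamma (m / 2) > 0" "Gamma (d / 2) > 0" "Beta (m / 2 + p) (d / 2) > 0"
        using m False by (auto intro!: Gamma_real_pos simp: Beta_def divide_pos_pos)
      then show ?thesis by (subst ennreal_mult3[symmetric]) (simp_all add: mult.assoc)
    qed
    also have "pi powr (d / 2) / Gamma (d / 2) * (pi powr (m / 2) / Gamma (m / 2) * Beta (m / 2 + p) (d / 2)) =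
      pi powr (n / 2) * Gamma (m / 2 + p) / (Gamma (m / 2) * Gamma (n / 2 + p))"
    proof -
      have "Gamma (d / 2) > 0" using False by (auto intro!: Gamma_real_pos)
      moreover have "real m / 2 + p + real d / 2 = real n / 2 + p" by (simp add: n field_simps)
      then have "Beta (m / 2 + p) (d / 2) = Gamma (m / 2 + p) * Gamma (d / 2) / Gamma (n / 2 + p)"
        by (simp only: Beta_def)
      moreover have "pi powr (n / 2) = pi powr (d / 2) * pi powr (m / 2)"
        by (simp add: n powr_add[symmetric] add_divide_distrib)
      ultimately show ?thesis by simp
    qed
    finally show ?thesis by (simp add: lebesgue_power_def sq_norm_row_def m_def)
  qed
qed

text \<open>The radial integral contributes \<open>Gamma (n / 2 + p)\<close>, which cancels the
  denominator in \<open>nn_integral_radial_tail\<close>. The full dimension \<open>n\<close>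
  disappears, as it must: the tail of a Gaussian vector is itself Gaussian.\<close>

lemma gaussian_tail_moment:
  assumes "d < \<beta> * N" "\<sigma> > 0" "p > - (real (\<beta> * N - d) / 2)"
  shows "(\<integral>\<^sup>+y. ennreal ((\<Sum>k=d..<\<beta> * N. (y k)\<^sup>2) powr p) * ennreal (gaussian_density \<beta> N \<sigma> y)
      \<partial>lebesgue_power (\<beta> * N)) =
    ennreal ((2 * \<sigma>\<^sup>2) powr p * (Gamma (real (\<beta> * N - d) / 2 + p) / Gamma (real (\<beta> * N - d) / 2)))"
proof -
  define n where "n = \<beta> * N"
  define m where "m = real (n - d)"
  define C where "C = (2 * pi * \<sigma>\<^sup>2) powr (- (n / 2))"
  have n: "real \<beta> * real N / 2 = n / 2" by (simp add: n_def)
  have dn: "d < n" "p > - (m / 2)"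
    using assms unfolding n_def m_def by blast+
  then have m: "m > 0" "m \<le> n"
    by (auto simp: m_def)
  have pos: "n / 2 + p > 0" "m / 2 + p > 0" "m > 0" "2 * \<sigma>\<^sup>2 > 0"
    using assms(2) dn m by auto
  then have G: "Gamma (n / 2 + p) > 0" "Gamma (m / 2 + p) > 0" "Gamma (m / 2) > 0"
    by (auto intro: Gamma_real_pos)
  have "(\<integral>\<^sup>+y. ennreal ((\<Sum>k=d..<n. (y k)\<^sup>2) powr p) * ennreal (gaussian_density \<beta> N \<sigma> y) \<partial>lebesgue_power n) =
    ennreal (pi powr (n / 2) * Gamma (m / 2 + p) / (Gamma (m / 2) * Gamma (n / 2 + p))) *
    (\<integral>\<^sup>+t\<in>{0<..}. ennreal (t powr (n / 2 + p - 1)) * ennreal (C * exp (- t / (2 * \<sigma>\<^sup>2))) \<partial>lborel)"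
    unfolding gaussian_density_def n C_def[symmetric] m_def n_def[symmetric]
    by (rule nn_integral_radial_tail[where h = "\<lambda>t. ennreal (C * exp (- t / (2 * \<sigma>\<^sup>2)))"])
      (use assms n_def in auto)
  also have "(\<integral>\<^sup>+t\<in>{0<..}. ennreal (t powr (n / 2 + p - 1)) * ennreal (C * exp (- t / (2 * \<sigma>\<^sup>2))) \<partial>lborel) =
    (\<integral>\<^sup>+t. ennreal C * (ennreal (t powr (n / 2 + p - 1) * exp (- t / (2 * \<sigma>\<^sup>2))) * indicator {0<..} t) \<partial>lborel)"
    by (intro nn_integral_cong) (auto simp: C_def ennreal_mult ac_simps)
  also have "\<dots> = ennreal C * ennreal ((2 * \<sigma>\<^sup>2) powr (n / 2 + p) * Gamma (n / 2 + p))"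
    using pos by (subst nn_integral_cmult, measurable) (subst nn_integral_Gamma, auto)
  also have "ennreal (pi powr (n / 2) * Gamma (m / 2 + p) / (Gamma (m / 2) * Gamma (n / 2 + p))) * \<dots> =
    ennreal ((pi powr (n / 2) * Gamma (m / 2 + p) / (Gamma (m / 2) * Gamma (n / 2 + p))) *
      (C * ((2 * \<sigma>\<^sup>2) powr (n / 2 + p) * Gamma (n / 2 + p))))"
    using G by (intro ennreal_mult3) (auto simp: C_def)
  also have "(pi powr (n / 2) * Gamma (m / 2 + p) / (Gamma (m / 2) * Gamma (n / 2 + p))) *
      (C * ((2 * \<sigma>\<^sup>2) powr (n / 2 + p) * Gamma (n / 2 + p))) =
      (2 * \<sigma>\<^sup>2) powr p * (Gamma (m / 2 + p) / Gamma (m / 2))"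
  proof -
    have "C = inverse (pi powr (n / 2) * (2 * \<sigma>\<^sup>2) powr (n / 2))"
      unfolding C_def powr_minus by (subst powr_mult[symmetric]) (simp_all add: mult_ac)
    moreover have "(2 * \<sigma>\<^sup>2) powr (n / 2 + p) = (2 * \<sigma>\<^sup>2) powr (n / 2) * (2 * \<sigma>\<^sup>2) powr p"
      by (rule powr_add)
    moreover have "(2 * \<sigma>\<^sup>2) powr (n / 2) > 0" using pos by simp
    ultimately show ?thesis using G by (simp only:) (simp add: divide_simps)
  qed
  finally show ?thesis by (simp add: n_def m_def)
qed

text \<open>With \<open>b = \<beta> * \<nu> / 2\<close> the radial integral is
  \<open>Beta (n / 2 + p) b\<close>. Its numerator cancels \<open>Gamma (n / 2 + p)\<close>, but its
  denominator \<open>Gamma (n / 2 + p + b)\<close> stays; this is the origin of the argument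
  \<open>\<beta> * (N + \<nu>) / 2\<close>.\<close>

lemma beta1_tail_moment:
  fixes \<nu> p :: real
  assumes "d < \<beta> * N" "\<nu> > 0" "p > - (real (\<beta> * N - d) / 2)"
  shows "(\<integral>\<^sup>+y. ennreal ((\<Sum>k=d..<\<beta> * N. (y k)\<^sup>2) powr p) * ennreal (beta1_density \<beta> N \<nu> y)
      \<partial>lebesgue_power (\<beta> * N)) =
    ennreal (Gamma (real (\<beta> * N - d) / 2 + p) / Gamma (real (\<beta> * N - d) / 2) *
      (Gamma (real \<beta> * (real N + \<nu>) / 2) / Gamma (real \<beta> * (real N + \<nu>) / 2 + p)))"
proof -
  define n where "n = \<beta> * N"
  define m where "m = real (n - d)"
  define b where "b = real \<beta> * \<nu> / 2"
  define C where "C = pi powr (- (n / 2)) * gen_pochhammer b (n / 2)"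
  have n: "real \<beta> * real N / 2 = n / 2" by (simp add: n_def)
  have nb: "real \<beta> * (real N + \<nu>) / 2 = n / 2 + b" by (simp add: n_def b_def field_simps)
  have dn: "d < n" "p > - (m / 2)"
    using assms unfolding n_def m_def by blast+
  then have m: "m > 0" "m \<le> n"
    by (auto simp: m_def)
  have "\<beta> > 0" using assms(1) by (cases "\<beta> = 0") auto
  then have b: "b > 0" using assms(2) by (simp add: b_def)
  then have pos: "n / 2 + p > 0" "m / 2 + p > 0" "m > 0" "b > 0" "b + n / 2 > 0"
    using dn m by auto
  then have G: "Gamma (n / 2 + p) > 0" "Gamma (m / 2 + p) > 0" "Gamma (m / 2) > 0" "Gamma b > 0"
      "Gamma (b + n / 2) > 0" "Gamma (n / 2 + p + b) > 0"
    by (auto intro: Gamma_real_pos)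
  then have C: "C > 0" by (simp add: C_def gen_pochhammer_def)
  let ?h = "\<lambda>t. ennreal (if t < 1 then C * (1 - t) powr (b - 1) else 0)"
  have "(\<integral>\<^sup>+y. ennreal ((\<Sum>k=d..<n. (y k)\<^sup>2) powr p) * ennreal (beta1_density \<beta> N \<nu> y) \<partial>lebesgue_power n) =
    ennreal (pi powr (n / 2) * Gamma (m / 2 + p) / (Gamma (m / 2) * Gamma (n / 2 + p))) *
    (\<integral>\<^sup>+t\<in>{0<..}. ennreal (t powr (n / 2 + p - 1)) * ?h t \<partial>lborel)"
    unfolding beta1_density_def n b_def[symmetric] C_def[symmetric] m_def n_def[symmetric]
    by (rule nn_integral_radial_tail[where h = ?h]) (use assms n_def in auto)
  also have "(\<integral>\<^sup>+t\<in>{0<..}. ennreal (t powr (n / 2 + p - 1)) * ?h t \<partial>lborel) =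
    (\<integral>\<^sup>+t. ennreal C * (ennreal (t powr (n / 2 + p - 1) * (1 - t) powr (b - 1)) * indicator {0<..<1} t) \<partial>lborel)"
    using C by (intro nn_integral_cong) (auto simp: ennreal_mult ac_simps indicator_def)
  also have "\<dots> = ennreal C * ennreal (Beta (n / 2 + p) b)"
    using pos by (subst nn_integral_cmult, measurable) (subst nn_integral_Beta, auto)
  also have "ennreal (pi powr (n / 2) * Gamma (m / 2 + p) / (Gamma (m / 2) * Gamma (n / 2 + p))) * \<dots> =
    ennreal ((pi powr (n / 2) * Gamma (m / 2 + p) / (Gamma (m / 2) * Gamma (n / 2 + p))) *
      (C * Beta (n / 2 + p) b))"
    using G C by (intro ennreal_mult3) (auto simp: Beta_def)
  also have "(pi powr (n / 2) * Gamma (m / 2 + p) / (Gamma (m / 2) * Gamma (n / 2 + p))) *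
      (C * Beta (n / 2 + p) b) =
      Gamma (m / 2 + p) / Gamma (m / 2) * (Gamma (n / 2 + b) / Gamma (n / 2 + b + p))"
    using G by (simp add: C_def gen_pochhammer_def Beta_def powr_minus field_simps)
  finally show ?thesis by (simp add: n_def[symmetric] m_def nb)
qed

text \<open>The exponent of \<open>1 + t\<close> splits as \<open>(n / 2 + p) + (b - p)\<close> with
  \<open>b = \<omega> / 2\<close>, which gives a beta prime integral. The moment therefore lowers
  the second parameter to \<open>b - p\<close>, and \<open>p < b\<close> is what convergence at
  infinity demands.\<close>

lemma beta2_tail_moment:
  fixes \<omega> p :: real
  assumes "d < \<beta> * N" "\<omega> > 0" "p > - (real (\<beta> * N - d) / 2)" "p < \<omega> / 2"
  shows "(\<integral>\<^sup>+y. ennreal ((\<Sum>k=d..<\<beta> * N. (y k)\<^sup>2) powr p) * ennreal (beta2_density \<beta> N \<omega> y)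
      \<partial>lebesgue_power (\<beta> * N)) =
    ennreal (Gamma (real (\<beta> * N - d) / 2 + p) / Gamma (real (\<beta> * N - d) / 2) *
      (Gamma (\<omega> / 2 - p) / Gamma (\<omega> / 2)))"
proof -
  define n where "n = \<beta> * N"
  define m where "m = real (n - d)"
  define b where "b = \<omega> / 2"
  define C where "C = pi powr (- (n / 2)) * gen_pochhammer b (n / 2)"
  have n: "real \<beta> * real N / 2 = n / 2" by (simp add: n_def)
  have ex: "- (real \<beta> * real N + \<omega>) / 2 = - ((n / 2 + p) + (b - p))" by (simp add: n_def b_def field_simps)
  have dn: "d < n" "p > - (m / 2)"
    using assms unfolding n_def m_def by blast+
  then have m: "m > 0" "m \<le> n"
    by (auto simp: m_def)
  have b: "b > 0" "p < b" using assms(2,4) by (simp_all add: b_def)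
  then have pos: "n / 2 + p > 0" "m / 2 + p > 0" "m > 0" "b > 0" "b + n / 2 > 0" "b - p > 0"
    using dn m by auto
  then have G: "Gamma (n / 2 + p) > 0" "Gamma (m / 2 + p) > 0" "Gamma (m / 2) > 0" "Gamma b > 0"
      "Gamma (b + n / 2) > 0" "Gamma (b - p) > 0"
    by (auto intro: Gamma_real_pos)
  then have C: "C > 0" by (simp add: C_def gen_pochhammer_def)
  let ?h = "\<lambda>t. ennreal (C * (1 + t) powr (- ((n / 2 + p) + (b - p))))"
  have "(\<integral>\<^sup>+y. ennreal ((\<Sum>k=d..<n. (y k)\<^sup>2) powr p) * ennreal (beta2_density \<beta> N \<omega> y) \<partial>lebesgue_power n) =
    ennreal (pi powr (n / 2) * Gamma (m / 2 + p) / (Gamma (m / 2) * Gamma (n / 2 + p))) *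
    (\<integral>\<^sup>+t\<in>{0<..}. ennreal (t powr (n / 2 + p - 1)) * ?h t \<partial>lborel)"
    unfolding beta2_density_def n ex b_def[symmetric] C_def[symmetric] m_def n_def[symmetric]
    by (rule nn_integral_radial_tail[where h = ?h]) (use assms n_def in auto)
  also have "(\<integral>\<^sup>+t\<in>{0<..}. ennreal (t powr (n / 2 + p - 1)) * ?h t \<partial>lborel) =
    (\<integral>\<^sup>+t. ennreal C * (ennreal (t powr (n / 2 + p - 1) * (1 + t) powr (- ((n / 2 + p) + (b - p)))) *
      indicator {0<..} t) \<partial>lborel)"
    using C by (intro nn_integral_cong) (auto simp: ennreal_mult ac_simps indicator_def)
  also have "\<dots> = ennreal C * ennreal (Beta (n / 2 + p) (b - p))"
    using pos by (subst nn_integral_cmult, measurable) (subst nn_integral_Beta_prime, auto)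
  also have "ennreal (pi powr (n / 2) * Gamma (m / 2 + p) / (Gamma (m / 2) * Gamma (n / 2 + p))) * \<dots> =
    ennreal ((pi powr (n / 2) * Gamma (m / 2 + p) / (Gamma (m / 2) * Gamma (n / 2 + p))) *
      (C * Beta (n / 2 + p) (b - p)))"
    using G C by (intro ennreal_mult3) (auto simp: Beta_def add.commute)
  also have "(pi powr (n / 2) * Gamma (m / 2 + p) / (Gamma (m / 2) * Gamma (n / 2 + p))) *
      (C * Beta (n / 2 + p) (b - p)) =
      Gamma (m / 2 + p) / Gamma (m / 2) * (Gamma (b - p) / Gamma b)"
    using G by (simp add: C_def gen_pochhammer_def Beta_def powr_minus field_simps)
  finally show ?thesis by (simp add: n_def[symmetric] m_def b_def)
qed

section \<open>Differentiating moments at the exponent 0\<close>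

lemma Gamma_ratio_derivative:
  fixes a :: real
  assumes "a > 0"
  shows "((\<lambda>p. Gamma (a + p) / Gamma a) has_real_derivative Digamma a) (at 0)"
    and "((\<lambda>p. Gamma a / Gamma (a + p)) has_real_derivative - Digamma a) (at 0)"
    and "((\<lambda>p. Gamma (a - p) / Gamma a) has_real_derivative - Digamma a) (at 0)"
proof -
  have a: "a \<notin> \<int>\<^sub>\<le>\<^sub>0" "Gamma a \<noteq> 0"
    using assms Gamma_real_pos[OF assms] by (auto elim!: nonpos_Ints_cases simp del: Gamma_real_pos)
  show "((\<lambda>p. Gamma (a + p) / Gamma a) has_real_derivative Digamma a) (at 0)"
    "((\<lambda>p. Gamma a / Gamma (a + p)) has_real_derivative - Digamma a) (at 0)"
    "((\<lambda>p. Gamma (a - p) / Gamma a) has_real_derivative - Digamma a) (at 0)"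
    using a by (auto intro!: derivative_eq_intros simp: field_simps)
qed

text \<open>Where \<open>Z = 0\<close>, \<open>Z powr p\<close> (even for \<open>p = 0\<close>) and \<open>ln Z\<close> are both \<open>0\<close>, so the junk values agree.\<close>

lemma (in prob_space) expectation_ln_of_moments:
  fixes Z :: "'a \<Rightarrow> real" and \<phi> :: "real \<Rightarrow> real"
  assumes [measurable]: "Z \<in> borel_measurable M" and Z: "\<And>s. Z s \<ge> 0"
    and "\<epsilon> > 0" and \<phi>: "\<And>p. \<bar>p\<bar> < \<epsilon> \<Longrightarrow> \<phi> p \<ge> 0"
    and mom: "\<And>p. \<bar>p\<bar> < \<epsilon> \<Longrightarrow> (\<integral>\<^sup>+s. ennreal (Z s powr p) \<partial>M) = ennreal (\<phi> p)"
    and D: "(\<phi> has_real_derivative D) (at 0)"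
  shows "integrable M (\<lambda>s. ln (Z s))" and "expectation (\<lambda>s. ln (Z s)) = D"
proof -
  define \<delta> where "\<delta> = \<epsilon> / 2"
  have \<delta>: "\<delta> > 0" "\<delta> < \<epsilon>" using \<open>\<epsilon> > 0\<close> by (auto simp: \<delta>_def)
  define P where "P = (\<lambda>n. \<delta> / real (Suc n))"
  have P: "0 < P n" "P n \<le> \<delta>" for n using \<delta> by (auto simp: P_def divide_le_eq)
  have P': "\<bar>P n\<bar> < \<epsilon>" for n using P[of n] \<delta> by linarith
  have P0: "P \<longlonglongrightarrow> 0"
    unfolding P_def by real_asymp
  have int: "integrable M (\<lambda>s. Z s powr p)" "expectation (\<lambda>s. Z s powr p) = \<phi> p" if "\<bar>p\<bar> < \<epsilon>" for p
  proof -
    show "integrable M (\<lambda>s. Z s powr p)"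
      using mom[OF that] by (intro integrableI_nonneg) auto
    show "expectation (\<lambda>s. Z s powr p) = \<phi> p"
      using mom[OF that] \<phi>[OF that] by (subst integral_eq_nn_integral) auto
  qed
  define X where "X = (\<lambda>n s. (Z s powr P n - Z s powr 0) / P n)"
  \<comment> \<open>Common bound for the difference quotients. For \<open>L = ln (Z s)\<close> and
    exponents \<open>t\<close> in (0, \<open>\<delta>\<close>], convexity gives \<open>(exp (t * L)
    - 1) / t \<le> (exp (\<delta> * L) - 1) / \<delta>\<close>; from below the quotient is at least
    \<open>L\<close>, hence at least \<open>(1 - exp (- \<delta> * L)) / \<delta>\<close>. The
    moments of exponents \<open>\<delta>\<close> and \<open>- \<delta>\<close> make \<open>W\<close>
    integrable.\<close>
  define W where "W = (\<lambda>s. (Z s powr \<delta> + Z s powr (- \<delta>)) / \<delta>)"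
  have intW: "integrable M W"
    unfolding W_def using \<delta> by (intro integrable_divide_zero Bochner_Integration.integrable_add int) auto
  have bound: "\<bar>X n s\<bar> \<le> W s" for n s
  proof (cases "Z s = 0")
    case False
    define L where "L = ln (Z s)"
    have pw: "Z s powr p = exp (p * L)" for p using False Z by (simp add: powr_def L_def)
    define q where "q = P n / \<delta>"
    have q: "0 < q" "q \<le> 1" "P n = q * \<delta>" using P[of n] \<delta> by (auto simp: q_def)
    have "exp (P n * L) \<le> (1 - q) * exp 0 + q * exp (\<delta> * L)"
      using convex_onD[OF exp_convex, of q 0 "\<delta> * L"] q by (simp add: mult_ac)
    then have "exp (P n * L) - 1 \<le> q * (exp (\<delta> * L) - 1)" by (simp add: algebra_simps)
    also have "\<dots> \<le> q * (exp (\<delta> * L) + exp (- \<delta> * L))"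
      using q exp_ge_zero[of "- \<delta> * L"] by (intro mult_left_mono) (linarith+)
    finally have 1: "exp (P n * L) - 1 \<le> q * (exp (\<delta> * L) + exp (- \<delta> * L))" .
    have "1 - \<delta> * L \<le> exp (- \<delta> * L)" using exp_ge_add_one_self[of "- \<delta> * L"] by simp
    then have "q * (1 - exp (- \<delta> * L)) \<le> q * (\<delta> * L)" using q by (intro mult_left_mono) auto
    also have "\<dots> \<le> exp (P n * L) - 1" using exp_ge_add_one_self[of "P n * L"] unfolding q(3) mult.assoc by linarith
    finally have "1 - exp (P n * L) \<le> q * (exp (- \<delta> * L) - 1)" by (simp add: algebra_simps)
    also have "\<dots> \<le> q * (exp (\<delta> * L) + exp (- \<delta> * L))" using q by (intro mult_left_mono) (auto simp: add_increasing)
    finally have "\<bar>exp (P n * L) - 1\<bar> \<le> q * (exp (\<delta> * L) + exp (- \<delta> * L))" using 1 by linarith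
    then have "\<bar>exp (P n * L) - 1\<bar> / P n \<le> (q * (exp (\<delta> * L) + exp (- \<delta> * L))) / P n"
      using P[of n] by (intro divide_right_mono) auto
    also have "\<dots> = (exp (\<delta> * L) + exp (- \<delta> * L)) / \<delta>" using q \<delta> by simp
    finally have b: "\<bar>exp (P n * L) - 1\<bar> / P n \<le> (exp (\<delta> * L) + exp (- \<delta> * L)) / \<delta>" .
    have "\<bar>X n s\<bar> = \<bar>exp (P n * L) - 1\<bar> / P n"
      unfolding X_def pw using P(1)[of n] by (simp add: abs_divide)
    with b show ?thesis unfolding W_def pw by (simp only:)
  qed (use \<delta> in \<open>simp add: X_def W_def\<close>)
  have lim: "(\<lambda>n. X n s) \<longlonglongrightarrow> ln (Z s)" for s
  proof (cases "Z s = 0")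
    case False
    have "((\<lambda>p. Z s powr p) has_real_derivative ln (Z s)) (at 0)"
      using False Z[of s] by (auto intro!: derivative_eq_intros)
    then have "((\<lambda>h. (Z s powr (0 + h) - Z s powr 0) / h) \<longlongrightarrow> ln (Z s)) (at 0)"
      by (simp add: DERIV_def)
    from this[unfolded tendsto_at_iff_sequentially, rule_format, of P]
    show ?thesis using P P0 by (auto simp: X_def o_def less_imp_neq[THEN not_sym])
  qed (simp add: X_def)
  have X_meas: "X n \<in> borel_measurable M" for n
    unfolding X_def by measurable
  have ln_meas: "(\<lambda>s. ln (Z s)) \<in> borel_measurable M"
    by measurable
  have lim': "AE s in M. (\<lambda>n. X n s) \<longlonglongrightarrow> ln (Z s)" using lim by (intro AE_I2)
  have bound': "AE s in M. norm (X n s) \<le> W s" for n using bound by (intro AE_I2) (simp only: real_norm_def)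
  have "integrable M (\<lambda>s. ln (Z s))"
    by (rule integrable_dominated_convergence[OF ln_meas X_meas intW lim' bound'])
  moreover have "(\<lambda>n. expectation (X n)) \<longlonglongrightarrow> expectation (\<lambda>s. ln (Z s))"
    by (rule integral_dominated_convergence[OF ln_meas X_meas intW lim' bound'])
  moreover have "(\<lambda>n. expectation (X n)) \<longlonglongrightarrow> D"
  proof -
    have "expectation (X n) = (\<phi> (0 + P n) - \<phi> 0) / P n" for n
      unfolding X_def using int[of "P n"] int[of 0] P'[of n] \<open>\<epsilon> > 0\<close> by simp
    moreover from D have "((\<lambda>h. (\<phi> (0 + h) - \<phi> 0) / h) \<longlongrightarrow> D) (at 0)"
      by (simp add: DERIV_def)
    from this[unfolded tendsto_at_iff_sequentially, rule_format, of P]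
    have "(\<lambda>n. (\<phi> (0 + P n) - \<phi> 0) / P n) \<longlonglongrightarrow> D"
      using P P0 by (auto simp: o_def less_imp_neq[THEN not_sym])
    ultimately show ?thesis by simp
  qed
  ultimately show "integrable M (\<lambda>s. ln (Z s))" "expectation (\<lambda>s. ln (Z s)) = D"
    by (auto dest: LIMSEQ_unique)
qed

section \<open>Reflections and invariant laws of rows\<close>

text \<open>If \<open>w\<close> vanishes on the first \<open>n\<close> coordinates, division by
  \<open>0\<close> makes this the identity there, so a degenerate direction needs no separate
  treatment. The restriction keeps the result a point of the product space.\<close>

definition reflect :: "nat \<Rightarrow> (nat \<Rightarrow> real) \<Rightarrow> (nat \<Rightarrow> real) \<Rightarrow> nat \<Rightarrow> real" where
  "reflect n w x = (\<lambda>k\<in>{..<n}. x k - 2 * (\<Sum>j<n. x j * w j) / (\<Sum>j<n. (w j)\<^sup>2) * w k)"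

definition drop_coords :: "nat \<Rightarrow> nat \<Rightarrow> (nat \<Rightarrow> real) \<Rightarrow> nat \<Rightarrow> real" where
  "drop_coords d n y = (\<lambda>k\<in>{..<n}. y (k + d))"

section \<open>Measurability and algebra of real reflections\<close>

lemma sets_lebesgue_power [measurable_cong]:
  "sets (lebesgue_power n) = sets (\<Pi>\<^sub>M k\<in>{..<n}. (borel :: real measure))"
  unfolding lebesgue_power_def by (rule sets_PiM_cong) auto

lemma space_lebesgue_power: "space (lebesgue_power n) = extensional {..<n}"
  by (auto simp: lebesgue_power_def space_PiM PiE_def)

lemma measurable_coord [measurable]:
  "k < n \<Longrightarrow> (\<lambda>y. y k) \<in> borel_measurable (lebesgue_power n)"
  unfolding lebesgue_power_def by simp

lemma measurable_lebesgue_powerI: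
  assumes "\<And>k. k < n \<Longrightarrow> (\<lambda>x. f x k) \<in> borel_measurable M"
  shows "(\<lambda>x. \<lambda>k\<in>{..<n}. f x k) \<in> measurable M (lebesgue_power n)"
  unfolding lebesgue_power_def using assms by (intro measurable_restrict) auto

lemma measurable_sq_norm_row [measurable]: "sq_norm_row n \<in> borel_measurable (lebesgue_power n)"
  unfolding sq_norm_row_def by measurable

lemma measurable_reflect [measurable]: "reflect n w \<in> measurable (lebesgue_power n) (lebesgue_power n)"
  unfolding reflect_def by (rule measurable_lebesgue_powerI) measurable

lemma measurable_drop_coords [measurable]:
  "drop_coords d n \<in> measurable (lebesgue_power (n + d)) (lebesgue_power n)"
  unfolding drop_coords_def by (rule measurable_lebesgue_powerI) measurable

text \<open>Clears the denominator even for a zero direction, where both sides vanish; isometry and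
  involution then follow without a case distinction.\<close>

lemma reflect_coeff:
  fixes n :: nat and x w :: "nat \<Rightarrow> real"
  defines "c \<equiv> 2 * (\<Sum>j<n. x j * w j) / (\<Sum>j<n. (w j)\<^sup>2)"
  shows "c * (\<Sum>j<n. (w j)\<^sup>2) = 2 * (\<Sum>j<n. x j * w j)"
proof (cases "(\<Sum>j<n. (w j)\<^sup>2) = 0")
  case True
  then have "\<forall>j<n. w j = 0"
    by (subst (asm) sum_nonneg_eq_0_iff) auto
  then have "(\<Sum>j<n. x j * w j) = 0" by (intro sum.neutral) auto
  then show ?thesis by (simp add: True)
next
  case False
  then show ?thesis
    by (simp only: c_def times_divide_eq_left nonzero_mult_div_cancel_right not_False_eq_True)
qed

lemma sq_norm_row_reflect: "sq_norm_row n (reflect n w x) = sq_norm_row n x"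
proof -
  define c where "c = 2 * (\<Sum>j<n. x j * w j) / (\<Sum>j<n. (w j)\<^sup>2)"
  have "sq_norm_row n (reflect n w x) = (\<Sum>k<n. (x k - c * w k)\<^sup>2)"
    by (simp add: sq_norm_row_def reflect_def c_def)
  also have "\<dots> = sq_norm_row n x - 2 * c * (\<Sum>k<n. x k * w k) + c * (c * (\<Sum>k<n. (w k)\<^sup>2))"
    by (simp add: sq_norm_row_def power2_diff sum.distrib sum_subtractf sum_distrib_left
        power_mult_distrib power2_eq_square algebra_simps)
  finally show ?thesis
    by (simp add: c_def reflect_coeff)
qed

lemma reflect_add:
  "reflect n w (\<lambda>k. x k + y k) = (\<lambda>k\<in>{..<n}. reflect n w x k + reflect n w y k)"
  by (auto simp: reflect_def fun_eq_iff sum.distrib add_divide_distrib algebra_simps)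

lemma reflect_uminus: "reflect n w (\<lambda>k. - x k) = (\<lambda>k\<in>{..<n}. - reflect n w x k)"
  by (auto simp: reflect_def fun_eq_iff sum_negf)

lemma reflect_restrict: "reflect n w (\<lambda>k\<in>{..<n}. x k) = reflect n w x"
  by (auto simp: reflect_def fun_eq_iff)

lemma reflect_reflect:
  assumes "x \<in> extensional {..<n}"
  shows "reflect n w (reflect n w x) = x"
proof -
  define c where "c = 2 * (\<Sum>j<n. x j * w j) / (\<Sum>j<n. (w j)\<^sup>2)"
  have "(\<Sum>j<n. (x j - c * w j) * w j) = (\<Sum>j<n. x j * w j) - c * (\<Sum>j<n. (w j)\<^sup>2)"
    by (simp add: sum_subtractf sum_distrib_left power2_eq_square algebra_simps)
  also have "\<dots> = - (\<Sum>j<n. x j * w j)"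
    unfolding c_def reflect_coeff by simp
  finally have "2 * (\<Sum>j<n. (x j - c * w j) * w j) / (\<Sum>j<n. (w j)\<^sup>2) = - c"
    by (simp add: c_def)
  then have "reflect n w (\<lambda>k. x k - c * w k) = (\<lambda>k\<in>{..<n}. x k - c * w k - - c * w k)"
    by (simp only: reflect_def)
  moreover have "reflect n w (reflect n w x) = reflect n w (\<lambda>k. x k - c * w k)"
    by (simp only: reflect_restrict[of n w "\<lambda>k. x k - c * w k", symmetric])
      (simp only: reflect_def c_def)
  ultimately show ?thesis
    using assms by (auto simp: fun_eq_iff extensional_def)
qed

section \<open>Invariance of Lebesgue measure under reflections\<close>

lemma nn_integral_lebesgue_power_affine:
  fixes c :: real
  assumes "\<bar>c\<bar> = 1" and f[measurable]: "f \<in> borel_measurable (lebesgue_power n)"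
  shows "(\<integral>\<^sup>+y. f (\<lambda>k\<in>{..<n}. t k + c * y k) \<partial>lebesgue_power n) = (\<integral>\<^sup>+y. f y \<partial>lebesgue_power n)"
proof -
  interpret product_sigma_finite "\<lambda>_ :: nat. lborel :: real measure" ..
  let ?T = "\<lambda>y. \<lambda>k\<in>{..<n}. t k + c * y k"
  have T[measurable]: "?T \<in> measurable (lebesgue_power n) (lebesgue_power n)"
    by (rule measurable_lebesgue_powerI) measurable
  have "distr (lebesgue_power n) (lebesgue_power n) ?T = (\<Pi>\<^sub>M k\<in>{..<n}. lborel)"
  proof (rule PiM_eqI)
    fix A :: "nat \<Rightarrow> real set" assume A: "\<And>i. i \<in> {..<n} \<Longrightarrow> A i \<in> sets lborel"
    have "emeasure (distr (lebesgue_power n) (lebesgue_power n) ?T) (Pi\<^sub>E {..<n} A) =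
        emeasure (lebesgue_power n) (?T -` Pi\<^sub>E {..<n} A \<inter> space (lebesgue_power n))"
    proof (rule emeasure_distr[OF T])
      show "Pi\<^sub>E {..<n} A \<in> sets (lebesgue_power n)"
        unfolding lebesgue_power_def using A by (intro sets_PiM_I_finite) auto
    qed
    also have "?T -` Pi\<^sub>E {..<n} A \<inter> space (lebesgue_power n) =
        (\<Pi>\<^sub>E k\<in>{..<n}. (\<lambda>z. t k + c * z) -` A k)"
      unfolding space_lebesgue_power
    proof (intro equalityI subsetI)
      fix y assume "y \<in> ?T -` Pi\<^sub>E {..<n} A \<inter> extensional {..<n}"
      then show "y \<in> (\<Pi>\<^sub>E k\<in>{..<n}. (\<lambda>z. t k + c * z) -` A k)" by (auto intro!: PiE_I simp: extensional_def)
    next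
      fix y assume "y \<in> (\<Pi>\<^sub>E k\<in>{..<n}. (\<lambda>z. t k + c * z) -` A k)"
      then show "y \<in> ?T -` Pi\<^sub>E {..<n} A \<inter> extensional {..<n}" by (auto simp: PiE_def Pi_def)
    qed
    also have "emeasure (lebesgue_power n) \<dots> = (\<Prod>k<n. emeasure lborel ((\<lambda>z. t k + c * z) -` A k))"
      unfolding lebesgue_power_def
    proof (rule emeasure_PiM)
      fix k assume "k \<in> {..<n}"
      then have [measurable]: "A k \<in> sets borel" using A by simp
      have "(\<lambda>z. t k + c * z) -` A k \<inter> space borel \<in> sets borel" by measurable
      then show "(\<lambda>z. t k + c * z) -` A k \<in> sets lborel" by simp
    qed simp
    also have "\<dots> = (\<Prod>k<n. emeasure lborel (A k))"
    proof (rule prod.cong)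
      fix k assume "k \<in> {..<n}"
      then have [measurable]: "A k \<in> sets borel" using A by simp
      have "emeasure lborel (A k) = (\<integral>\<^sup>+z. indicator (A k) z \<partial>lborel)"
        by simp
      also have "\<dots> = \<bar>c\<bar> * (\<integral>\<^sup>+z. indicator (A k) (t k + c * z) \<partial>lborel)"
        using assms by (intro nn_integral_real_affine) auto
      also have "\<dots> = (\<integral>\<^sup>+z. indicator ((\<lambda>z. t k + c * z) -` A k \<inter> space borel) z \<partial>lborel)"
        using assms by (auto intro!: nn_integral_cong simp: indicator_def)
      also have "\<dots> = emeasure lborel ((\<lambda>z. t k + c * z) -` A k \<inter> space borel)"
        by (rule nn_integral_indicator) measurable
      finally show "emeasure lborel ((\<lambda>z. t k + c * z) -` A k) = emeasure lborel (A k)" by simp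
    qed simp
    finally show "emeasure (distr (lebesgue_power n) (lebesgue_power n) ?T) (Pi\<^sub>E {..<n} A) =
      (\<Prod>k<n. emeasure lborel (A k))" .
  qed (auto simp: lebesgue_power_def)
  then have "(\<integral>\<^sup>+y. f y \<partial>lebesgue_power n) =
      (\<integral>\<^sup>+y. f y \<partial>distr (lebesgue_power n) (lebesgue_power n) ?T)"
    by (simp add: lebesgue_power_def)
  also have "\<dots> = (\<integral>\<^sup>+y. f (?T y) \<partial>lebesgue_power n)"
    by (rule nn_integral_distr) measurable
  finally show ?thesis ..
qed

text \<open>
  Uniqueness of Haar measure: for translation invariant \<open>\<mu>\<close> and \<open>\<lambda>\<close>, Fubini's theorem gives
  \<open>\<mu> f \<cdot> \<lambda> g = \<mu> g \<cdot> \<lambda> f\<close>. Take \<open>\<mu>\<close> to be the image of \<open>\<lambda>\<close> and \<open>g\<close> the indicator of the unit ball.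
\<close>

lemma nn_integral_reflect:
  assumes f[measurable]: "f \<in> borel_measurable (lebesgue_power n)"
  shows "(\<integral>\<^sup>+x. f (reflect n w x) \<partial>lebesgue_power n) = (\<integral>\<^sup>+x. f x \<partial>lebesgue_power n)"
proof -
  interpret P: product_sigma_finite "\<lambda>_ :: nat. lborel :: real measure" ..
  interpret F: finite_product_sigma_finite "\<lambda>_ :: nat. lborel :: real measure" "{..<n}" by standard simp
  let ?L = "lebesgue_power n" and ?R = "reflect n w"
  interpret pair_sigma_finite ?L ?L
    unfolding lebesgue_power_def by standard
  define g :: "(nat \<Rightarrow> real) \<Rightarrow> ennreal" where "g y = (if sq_norm_row n y \<le> 1 then 1 else 0)" for y
  define G where "G = (\<integral>\<^sup>+y. g y \<partial>?L)"
  have [measurable]: "g \<in> borel_measurable ?L"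
    unfolding g_def by measurable
  have "G = (\<integral>\<^sup>+y. indicator ({y. sqrt (\<Sum>k<n. (y k)\<^sup>2) \<le> 1} \<inter> space ?L) y \<partial>?L)"
    unfolding G_def by (intro nn_integral_cong) (auto simp: g_def sq_norm_row_def indicator_def)
  also have "\<dots> = emeasure ?L ({y. sqrt (\<Sum>k<n. (y k)\<^sup>2) \<le> 1} \<inter> space ?L)"
    by (rule nn_integral_indicator) measurable
  also have "\<dots> = ennreal (unit_ball_vol n)"
    using emeasure_cball_aux[of "{..<n}" 1] by (simp add: lebesgue_power_def)
  finally have G: "G \<noteq> 0" "G \<noteq> \<infinity>"
    using unit_ball_vol_pos[of "real n"] by (simp_all add: ennreal_eq_0_iff not_le)
  have [measurable]: "(\<lambda>p. \<lambda>k\<in>{..<n}. ?R (fst p) k + c * snd p k) \<in> measurable (?L \<Otimes>\<^sub>M ?L) ?L" for c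
  proof (rule measurable_lebesgue_powerI)
    fix k assume [arith]: "k < n"
    have [measurable]: "(\<lambda>p. ?R (fst p) k) \<in> borel_measurable (?L \<Otimes>\<^sub>M ?L)"
      by (rule measurable_compose[OF _ measurable_coord[of k n]]) auto
    have [measurable]: "(\<lambda>p. snd p k) \<in> borel_measurable (?L \<Otimes>\<^sub>M ?L)"
      by (rule measurable_compose[OF _ measurable_coord[of k n]]) auto
    show "(\<lambda>p. ?R (fst p) k + c * snd p k) \<in> borel_measurable (?L \<Otimes>\<^sub>M ?L)" by measurable
  qed
  have "(\<integral>\<^sup>+x. f (?R x) \<partial>?L) * G = (\<integral>\<^sup>+x. f (?R x) * (\<integral>\<^sup>+y. g y \<partial>?L) \<partial>?L)"
    unfolding G_def by (rule nn_integral_multc[symmetric]) measurable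
  also have "\<dots> = (\<integral>\<^sup>+x. f (?R x) * (\<integral>\<^sup>+y. g (\<lambda>k\<in>{..<n}. ?R x k + 1 * y k) \<partial>?L) \<partial>?L)"
    by (subst nn_integral_lebesgue_power_affine[where f = g]) auto
  also have "\<dots> = (\<integral>\<^sup>+x. \<integral>\<^sup>+y. f (?R x) * g (\<lambda>k\<in>{..<n}. ?R x k + 1 * y k) \<partial>?L \<partial>?L)"
  proof (intro nn_integral_cong nn_integral_cmult[symmetric])
    fix x
    have "(\<lambda>y. \<lambda>k\<in>{..<n}. ?R x k + 1 * y k) \<in> measurable ?L ?L"
      by (rule measurable_lebesgue_powerI) measurable
    then show "(\<lambda>y. g (\<lambda>k\<in>{..<n}. ?R x k + 1 * y k)) \<in> borel_measurable ?L" by measurable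
  qed
  also have "\<dots> = (\<integral>\<^sup>+y. \<integral>\<^sup>+x. f (?R x) * g (\<lambda>k\<in>{..<n}. ?R x k + 1 * y k) \<partial>?L \<partial>?L)"
    by (rule Fubini'[symmetric]) (simp add: case_prod_beta')
  \<comment> \<open>Substitute \<open>x - ?R y\<close> for \<open>x\<close>. Since \<open>?R\<close>
    is an additive involution, \<open>?R x + y\<close> becomes \<open>?R x\<close>, and
    \<open>g\<close> depends only on the norm, so it does not distinguish \<open>?R x\<close> from
    \<open>x\<close>.\<close>
  also have "\<dots> = (\<integral>\<^sup>+y. \<integral>\<^sup>+x. f (\<lambda>k\<in>{..<n}. ?R x k + (- 1) * y k) * g x \<partial>?L \<partial>?L)"
  proof (rule nn_integral_cong)
    fix y assume "y \<in> space ?L"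
    then have y: "y \<in> extensional {..<n}" by (simp add: space_lebesgue_power)
    let ?F = "\<lambda>x. f (?R x) * g (\<lambda>k\<in>{..<n}. ?R x k + 1 * y k)"
    have "(\<lambda>x. \<lambda>k\<in>{..<n}. ?R x k + 1 * y k) \<in> measurable ?L ?L"
      by (rule measurable_lebesgue_powerI, rule borel_measurable_add)
        (auto intro: measurable_compose[OF measurable_reflect measurable_coord])
    then have "(\<integral>\<^sup>+x. ?F x \<partial>?L) = (\<integral>\<^sup>+x. ?F (\<lambda>k\<in>{..<n}. - ?R y k + 1 * x k) \<partial>?L)"
      by (subst nn_integral_lebesgue_power_affine) auto
    also have "\<dots> = (\<integral>\<^sup>+x. f (\<lambda>k\<in>{..<n}. ?R x k + (- 1) * y k) * g x \<partial>?L)"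
    proof (rule nn_integral_cong)
      fix x assume "x \<in> space ?L"
      then have x: "x \<in> extensional {..<n}" by (simp add: space_lebesgue_power)
      have R: "?R (\<lambda>k\<in>{..<n}. - ?R y k + 1 * x k) = (\<lambda>k\<in>{..<n}. ?R x k + (- 1) * y k)"
        by (subst reflect_restrict, subst mult_1, subst reflect_add)
          (auto simp: reflect_uminus reflect_reflect[OF y] fun_eq_iff)
      have "(\<lambda>k\<in>{..<n}. (\<lambda>k\<in>{..<n}. ?R x k + (- 1) * y k) k + 1 * y k) = ?R x"
        by (auto simp: fun_eq_iff reflect_def)
      then show "?F (\<lambda>k\<in>{..<n}. - ?R y k + 1 * x k) = f (\<lambda>k\<in>{..<n}. ?R x k + (- 1) * y k) * g x"
        unfolding R by (simp add: g_def sq_norm_row_reflect)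
    qed
    finally show "(\<integral>\<^sup>+x. ?F x \<partial>?L) = (\<integral>\<^sup>+x. f (\<lambda>k\<in>{..<n}. ?R x k + (- 1) * y k) * g x \<partial>?L)" .
  qed
  also have "\<dots> = (\<integral>\<^sup>+x. \<integral>\<^sup>+y. f (\<lambda>k\<in>{..<n}. ?R x k + (- 1) * y k) * g x \<partial>?L \<partial>?L)"
    by (rule Fubini') (simp add: case_prod_beta')
  \<comment> \<open>For fixed \<open>x\<close> the map taking \<open>y\<close> to
    \<open>?R x - y\<close> preserves Lebesgue measure; this is where the sign
    \<open>c = - 1\<close> is needed.\<close>
  also have "\<dots> = (\<integral>\<^sup>+x. (\<integral>\<^sup>+y. f y \<partial>?L) * g x \<partial>?L)"
  proof (rule nn_integral_cong)
    fix x
    have "(\<lambda>y. \<lambda>k\<in>{..<n}. ?R x k + (- 1) * y k) \<in> measurable ?L ?L"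
      by (rule measurable_lebesgue_powerI) measurable
    then have "(\<integral>\<^sup>+y. f (\<lambda>k\<in>{..<n}. ?R x k + (- 1) * y k) * g x \<partial>?L) =
        (\<integral>\<^sup>+y. f (\<lambda>k\<in>{..<n}. ?R x k + (- 1) * y k) \<partial>?L) * g x"
      by (intro nn_integral_multc) measurable
    then show "(\<integral>\<^sup>+y. f (\<lambda>k\<in>{..<n}. ?R x k + (- 1) * y k) * g x \<partial>?L) = (\<integral>\<^sup>+y. f y \<partial>?L) * g x"
      by (subst (asm) nn_integral_lebesgue_power_affine) auto
  qed
  also have "\<dots> = (\<integral>\<^sup>+y. f y \<partial>?L) * G"
    unfolding G_def by (rule nn_integral_cmult) measurable
  finally show ?thesis
    using G by (simp add: mult.commute[of _ G] ennreal_mult_cancel_left)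
qed

text \<open>The induction moves rows by reflections only. Stating invariance for the law instead of
  a shape for its density lets the property pass to marginals, whose densities are never
  computed.\<close>

definition radial :: "nat \<Rightarrow> (nat \<Rightarrow> real) measure \<Rightarrow> bool" where
  "radial n \<mu> \<longleftrightarrow> prob_space \<mu> \<and> sets \<mu> = sets (lebesgue_power n) \<and>
     (\<forall>w. distr \<mu> (lebesgue_power n) (reflect n w) = \<mu>)"

lemma radial_density:
  assumes [measurable]: "h \<in> borel_measurable borel"
    and "prob_space (density (lebesgue_power n) (\<lambda>y. h (sq_norm_row n y)))"
  shows "radial n (density (lebesgue_power n) (\<lambda>y. h (sq_norm_row n y)))"
  unfolding radial_def
proof (intro conjI allI assms)
  let ?L = "lebesgue_power n"
  fix w
  let ?R = "reflect n w"
  show "distr (density ?L (\<lambda>y. h (sq_norm_row n y))) ?L ?R = density ?L (\<lambda>y. h (sq_norm_row n y))"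
  proof (rule measure_eqI)
    fix A assume "A \<in> sets (distr (density ?L (\<lambda>y. h (sq_norm_row n y))) ?L ?R)"
    then have [measurable]: "A \<in> sets ?L" by simp
    have "?R -` A \<inter> space ?L \<in> sets ?L" by measurable
    then have "emeasure (distr (density ?L (\<lambda>y. h (sq_norm_row n y))) ?L ?R) A =
        (\<integral>\<^sup>+y. h (sq_norm_row n y) * indicator (?R -` A \<inter> space ?L) y \<partial>?L)"
      by (simp add: emeasure_distr emeasure_density)
    also have "\<dots> = (\<integral>\<^sup>+y. h (sq_norm_row n (?R y)) * indicator A (?R y) \<partial>?L)"
      by (intro nn_integral_cong) (auto simp: sq_norm_row_reflect indicator_def)
    also have "\<dots> = (\<integral>\<^sup>+y. h (sq_norm_row n y) * indicator A y \<partial>?L)"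
      by (rule nn_integral_reflect) measurable
    also have "\<dots> = emeasure (density ?L (\<lambda>y. h (sq_norm_row n y))) A"
      by (simp add: emeasure_density)
    finally show "emeasure (distr (density ?L (\<lambda>y. h (sq_norm_row n y))) ?L ?R) A =
      emeasure (density ?L (\<lambda>y. h (sq_norm_row n y))) A" .
  qed simp
qed simp

lemma measurable_fold_reflect [measurable]:
  "fold (reflect n) ws \<in> measurable (lebesgue_power n) (lebesgue_power n)"
proof (induction ws)
  case (Cons w ws)
  then show ?case by (auto intro!: measurable_comp)
qed simp

lemma distr_fold_reflect:
  assumes "radial n \<mu>"
  shows "distr \<mu> (lebesgue_power n) (fold (reflect n) ws) = \<mu>"
proof (induction ws)
  case Nil
  then show ?case using assms by (auto simp: radial_def intro: distr_id2)
next
  case (Cons w ws)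
  have [measurable_cong]: "sets \<mu> = sets (lebesgue_power n)" using assms by (simp add: radial_def)
  have "distr \<mu> (lebesgue_power n) (fold (reflect n) (w # ws)) =
      distr (distr \<mu> (lebesgue_power n) (reflect n w)) (lebesgue_power n) (fold (reflect n) ws)"
    by (subst distr_distr) (simp_all add: measurable_cong_sets[of \<mu> "lebesgue_power n"] assms \<open>sets \<mu> = _\<close>)
  also have "\<dots> = \<mu>" using assms Cons by (simp add: radial_def)
  finally show ?case .
qed

text \<open>A reflection of the remaining coordinates in direction \<open>w\<close> lifts to the
  reflection of all coordinates in the direction \<open>w\<close> padded with \<open>d\<close>
  leading zeros; the lift commutes with dropping and preserves \<open>\<mu>\<close>.\<close>

lemma radial_drop_coords:
  assumes "radial (n + d) \<mu>"
  shows "radial n (distr \<mu> (lebesgue_power n) (drop_coords d n))"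
proof -
  interpret prob_space \<mu> using assms by (simp add: radial_def)
  have [measurable_cong]: "sets \<mu> = sets (lebesgue_power (n + d))"
    and inv: "distr \<mu> (lebesgue_power (n + d)) (reflect (n + d) w) = \<mu>" for w
    using assms by (simp_all add: radial_def)
  have [measurable]: "drop_coords d n \<in> measurable \<mu> (lebesgue_power n)"
    "reflect (n + d) w \<in> measurable \<mu> (lebesgue_power (n + d))" for w
    using \<open>sets \<mu> = _\<close> by (simp_all cong: measurable_cong_sets)
  have shift: "(\<Sum>j<n + d. if j < d then 0 else f (j - d)) = (\<Sum>j<n. f j)" for f :: "nat \<Rightarrow> real"
    by (induction n) (auto intro: sum.neutral)
  have "distr (distr \<mu> (lebesgue_power n) (drop_coords d n)) (lebesgue_power n) (reflect n w) =
      distr \<mu> (lebesgue_power n) (drop_coords d n)" for w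
  proof -
    define w' where "w' = (\<lambda>k. if k < d then 0 else w (k - d))"
    have s1: "(\<Sum>j<n + d. (w' j)\<^sup>2) = (\<Sum>j<n. (w j)\<^sup>2)"
      unfolding shift[symmetric] by (intro sum.cong) (auto simp: w'_def)
    have s2: "(\<Sum>j<n + d. x j * w' j) = (\<Sum>j<n. x (j + d) * w j)" for x
      unfolding shift[symmetric] by (intro sum.cong) (auto simp: w'_def)
    have "reflect n w (drop_coords d n x) = drop_coords d n (reflect (n + d) w' x)" for x
      by (auto simp: reflect_def drop_coords_def fun_eq_iff s1 s2) (auto simp: w'_def)
    then have comm: "reflect n w \<circ> drop_coords d n = drop_coords d n \<circ> reflect (n + d) w'"
      by (simp add: fun_eq_iff)
    have "distr (distr \<mu> (lebesgue_power n) (drop_coords d n)) (lebesgue_power n) (reflect n w) =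
        distr \<mu> (lebesgue_power n) (drop_coords d n \<circ> reflect (n + d) w')"
      by (subst distr_distr) (simp_all add: comm)
    also have "\<dots> = distr (distr \<mu> (lebesgue_power (n + d)) (reflect (n + d) w')) (lebesgue_power n) (drop_coords d n)"
      by (subst distr_distr) simp_all
    finally show ?thesis by (simp only: inv)
  qed
  then show ?thesis
    by (simp add: radial_def prob_space_distr)
qed

text \<open>
  The reflections \<open>ws\<close> may depend on row \<open>0\<close>, because the laws of the other rows are invariant
  under all of them.
\<close>

lemma nn_integral_radial_rows:
  fixes V :: "nat \<Rightarrow> (nat \<Rightarrow> nat \<Rightarrow> real) \<Rightarrow> real" and \<beta> :: nat and p :: real
  assumes V0: "\<And>Y. V 0 Y = 1"
    and V_nonneg: "\<And>N Y. V N Y \<ge> 0"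
    and V_cong: "\<And>N Y Y'. (\<And>i. i < N \<Longrightarrow> Y i = Y' i) \<Longrightarrow> V N Y = V N Y'"
    and V_meas: "\<And>N. V N \<in> borel_measurable (\<Pi>\<^sub>M i\<in>{..<N}. lebesgue_power (\<beta> * N))"
    and V_step: "\<And>N y. \<exists>ws. \<forall>Y. Y 0 = y \<longrightarrow> V (Suc N) Y = sq_norm_row (\<beta> * Suc N) y *
      V N (\<lambda>i. drop_coords \<beta> (\<beta> * N) (fold (reflect (\<beta> * Suc N)) ws (Y (Suc i))))"
    and rad: "\<And>i. radial (\<beta> * N) (\<mu> i)"
  shows "(\<integral>\<^sup>+Y. ennreal (V N (\<lambda>i. Y (i + k)) powr p) \<partial>(\<Pi>\<^sub>M i\<in>{k..<k + N}. \<mu> i)) =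
    (\<Prod>i<N. \<integral>\<^sup>+y. ennreal ((\<Sum>j=\<beta> * i..<\<beta> * N. (y j)\<^sup>2) powr p) \<partial>\<mu> (i + k))"
  using rad
\<comment> \<open>\<open>k\<close> and \<open>\<mu>\<close> vary because the remaining rows start at
  index \<open>Suc k\<close> and follow the marginal laws with \<open>\<beta>\<close> fewer
  coordinates.\<close>
proof (induction N arbitrary: k \<mu>)
  case 0
  interpret prob_space "\<Pi>\<^sub>M i\<in>{k..<k + 0}. \<mu> i"
    using 0 by (intro prob_space_PiM) (simp add: radial_def)
  show ?case by (simp add: V0 emeasure_space_1[simplified])
next
  case (Suc N k \<mu>)
  let ?n = "\<beta> * Suc N" and ?m = "\<beta> * N"
  let ?J = "{Suc k..<Suc k + N}"
  have prob: "prob_space (\<mu> i)" and sets[measurable_cong]: "sets (\<mu> i) = sets (lebesgue_power ?n)" for i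
    using Suc.prems by (simp_all add: radial_def)
  interpret product_prob_space \<mu>
    by (intro product_prob_spaceI prob)
  have meas_shift: "(\<lambda>Y. V N (\<lambda>i. Y (i + k))) \<in> borel_measurable (\<Pi>\<^sub>M i\<in>{k..<k + N}. \<mu> i)"
    if "\<And>i. sets (\<mu> i) = sets (lebesgue_power (\<beta> * N))" for N k \<mu>
  proof -
    have "(\<lambda>Y. \<lambda>i\<in>{..<N}. Y (i + k)) \<in>
        measurable (\<Pi>\<^sub>M i\<in>{k..<k + N}. lebesgue_power (\<beta> * N)) (\<Pi>\<^sub>M i\<in>{..<N}. lebesgue_power (\<beta> * N))"
      by (intro measurable_restrict) auto
    from measurable_compose[OF this V_meas]
    have "(\<lambda>Y. V N (\<lambda>i\<in>{..<N}. Y (i + k))) \<in>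
        borel_measurable (\<Pi>\<^sub>M i\<in>{k..<k + N}. lebesgue_power (\<beta> * N))" .
    also have "(\<lambda>Y. V N (\<lambda>i\<in>{..<N}. Y (i + k))) = (\<lambda>Y. V N (\<lambda>i. Y (i + k)))"
      by (intro ext V_cong) auto
    finally show ?thesis
      using that by (simp cong: measurable_cong_sets sets_PiM_cong)
  qed
  define \<mu>' where "\<mu>' = (\<lambda>i. distr (\<mu> i) (lebesgue_power ?m) (drop_coords \<beta> ?m))"
  have n: "?n = ?m + \<beta>" by simp
  have rad': "radial ?m (\<mu>' i)" for i
    unfolding \<mu>'_def using Suc.prems by (intro radial_drop_coords) (simp add: add.commute)
  have sets'[measurable_cong]: "sets (\<mu>' i) = sets (lebesgue_power ?m)" for i
    by (simp add: \<mu>'_def)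
  have drop_meas[measurable]: "drop_coords \<beta> ?m \<in> measurable (lebesgue_power ?n) (lebesgue_power ?m)"
    unfolding n by measurable
  have ins: "{k..<k + Suc N} = insert k ?J" by auto
  have "(\<integral>\<^sup>+Y. ennreal (V (Suc N) (\<lambda>i. Y (i + k)) powr p) \<partial>(\<Pi>\<^sub>M i\<in>{k..<k + Suc N}. \<mu> i)) =
      (\<integral>\<^sup>+y. \<integral>\<^sup>+Y. ennreal (V (Suc N) (\<lambda>i. (Y(k := y)) (i + k)) powr p) \<partial>(\<Pi>\<^sub>M i\<in>?J. \<mu> i) \<partial>\<mu> k)"
    unfolding ins
  proof (rule product_nn_integral_insert_rev)
    show "(\<lambda>Y. ennreal (V (Suc N) (\<lambda>i. Y (i + k)) powr p)) \<in> borel_measurable (\<Pi>\<^sub>M i\<in>insert k ?J. \<mu> i)"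
      using meas_shift[of \<mu> "Suc N" k] sets unfolding ins by simp
  qed auto
  also have "\<dots> = (\<integral>\<^sup>+y. ennreal (sq_norm_row ?n y powr p) *
      (\<Prod>i<N. \<integral>\<^sup>+y. ennreal ((\<Sum>j=\<beta> * i..<?m. (y j)\<^sup>2) powr p) \<partial>\<mu>' (i + Suc k)) \<partial>\<mu> k)"
  proof (rule nn_integral_cong)
    fix y
    obtain ws where ws: "\<And>Y. Y 0 = y \<Longrightarrow> V (Suc N) Y = sq_norm_row ?n y *
        V N (\<lambda>i. drop_coords \<beta> ?m (fold (reflect ?n) ws (Y (Suc i))))"
      using V_step by blast
    define F where "F = drop_coords \<beta> ?m \<circ> fold (reflect ?n) ws"
    have F[measurable]: "F \<in> measurable (lebesgue_power ?n) (lebesgue_power ?m)"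
      unfolding F_def by (intro measurable_comp) measurable
    \<comment> \<open>The transformed row has law \<open>\<mu>' i\<close> whatever \<open>ws\<close>
      is. Hence the remaining inner integral does not depend on \<open>y\<close>, and
      \<open>ws\<close> need not be chosen measurably in \<open>y\<close>.\<close>
    have F_law: "distr (\<mu> i) (\<mu>' i) F = \<mu>' i" for i
    proof -
      have "distr (\<mu> i) (\<mu>' i) F = distr (\<mu> i) (lebesgue_power ?m) F"
        by (rule distr_cong) (simp_all add: sets')
      also have "\<dots> = distr (distr (\<mu> i) (lebesgue_power ?n) (fold (reflect ?n) ws)) (lebesgue_power ?m) (drop_coords \<beta> ?m)"
        unfolding F_def by (rule distr_distr[symmetric]) (measurable)
      finally show ?thesis
        using Suc.prems by (simp add: distr_fold_reflect \<mu>'_def)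
    qed
    have "(\<integral>\<^sup>+Y. ennreal (V (Suc N) (\<lambda>i. (Y(k := y)) (i + k)) powr p) \<partial>(\<Pi>\<^sub>M i\<in>?J. \<mu> i)) =
        (\<integral>\<^sup>+Y. ennreal (sq_norm_row ?n y powr p) *
          ennreal (V N (\<lambda>i. compose ?J F Y (i + Suc k)) powr p) \<partial>(\<Pi>\<^sub>M i\<in>?J. \<mu> i))"
    proof (rule nn_integral_cong)
      fix Y
      have "V (Suc N) (\<lambda>i. (Y(k := y)) (i + k)) =
          sq_norm_row ?n y * V N (\<lambda>i. F (Y (i + Suc k)))"
        by (subst ws) (auto simp: F_def)
      also have "V N (\<lambda>i. F (Y (i + Suc k))) = V N (\<lambda>i. compose ?J F Y (i + Suc k))"
        by (rule V_cong) (simp add: compose_def)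
      finally show "ennreal (V (Suc N) (\<lambda>i. (Y(k := y)) (i + k)) powr p) =
          ennreal (sq_norm_row ?n y powr p) * ennreal (V N (\<lambda>i. compose ?J F Y (i + Suc k)) powr p)"
        by (simp add: powr_mult V_nonneg sq_norm_row_def sum_nonneg ennreal_mult)
    qed
    also have "\<dots> = ennreal (sq_norm_row ?n y powr p) *
        (\<integral>\<^sup>+Y. ennreal (V N (\<lambda>i. compose ?J F Y (i + Suc k)) powr p) \<partial>(\<Pi>\<^sub>M i\<in>?J. \<mu> i))"
    proof (rule nn_integral_cmult)
      have "compose ?J F \<in> measurable (\<Pi>\<^sub>M i\<in>?J. \<mu> i) (\<Pi>\<^sub>M i\<in>?J. \<mu>' i)"
        unfolding compose_def by (intro measurable_restrict) measurable
      from measurable_compose[OF this meas_shift[OF sets']]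
      show "(\<lambda>Y. ennreal (V N (\<lambda>i. compose ?J F Y (i + Suc k)) powr p)) \<in> borel_measurable (\<Pi>\<^sub>M i\<in>?J. \<mu> i)"
        by simp
    qed
    also have "(\<integral>\<^sup>+Y. ennreal (V N (\<lambda>i. compose ?J F Y (i + Suc k)) powr p) \<partial>(\<Pi>\<^sub>M i\<in>?J. \<mu> i)) =
        (\<integral>\<^sup>+Y. ennreal (V N (\<lambda>i. Y (i + Suc k)) powr p)
          \<partial>distr (\<Pi>\<^sub>M i\<in>?J. \<mu> i) (\<Pi>\<^sub>M i\<in>?J. \<mu>' i) (compose ?J F))"
    proof -
      have "compose ?J F \<in> measurable (\<Pi>\<^sub>M i\<in>?J. \<mu> i) (\<Pi>\<^sub>M i\<in>?J. \<mu>' i)"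
        unfolding compose_def by (intro measurable_restrict) measurable
      moreover have "(\<lambda>Y. ennreal (V N (\<lambda>i. Y (i + Suc k)) powr p)) \<in> borel_measurable (\<Pi>\<^sub>M i\<in>?J. \<mu>' i)"
        using meas_shift[of \<mu>' N "Suc k", OF sets'] by measurable
      ultimately show ?thesis
        by (subst nn_integral_distr) simp_all
    qed
    also have "distr (\<Pi>\<^sub>M i\<in>?J. \<mu> i) (\<Pi>\<^sub>M i\<in>?J. \<mu>' i) (compose ?J F) = (\<Pi>\<^sub>M i\<in>?J. distr (\<mu> i) (\<mu>' i) F)"
      using rad' by (intro distr_PiM_finite_prob_space product_prob_spaceI prob)
        (auto simp: radial_def)
    also have "\<dots> = (\<Pi>\<^sub>M i\<in>?J. \<mu>' i)"
      by (simp only: F_law)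
    also have "(\<integral>\<^sup>+Y. ennreal (V N (\<lambda>i. Y (i + Suc k)) powr p) \<partial>(\<Pi>\<^sub>M i\<in>?J. \<mu>' i)) =
        (\<Prod>i<N. \<integral>\<^sup>+y. ennreal ((\<Sum>j=\<beta> * i..<?m. (y j)\<^sup>2) powr p) \<partial>\<mu>' (i + Suc k))"
      by (rule Suc.IH[OF rad'])
    finally show "(\<integral>\<^sup>+Y. ennreal (V (Suc N) (\<lambda>i. (Y(k := y)) (i + k)) powr p) \<partial>(\<Pi>\<^sub>M i\<in>?J. \<mu> i)) =
        ennreal (sq_norm_row ?n y powr p) *
        (\<Prod>i<N. \<integral>\<^sup>+y. ennreal ((\<Sum>j=\<beta> * i..<?m. (y j)\<^sup>2) powr p) \<partial>\<mu>' (i + Suc k))" .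
  qed
  also have "\<dots> = (\<integral>\<^sup>+y. ennreal (sq_norm_row ?n y powr p) \<partial>\<mu> k) *
      (\<Prod>i<N. \<integral>\<^sup>+y. ennreal ((\<Sum>j=\<beta> * i..<?m. (y j)\<^sup>2) powr p) \<partial>\<mu>' (i + Suc k))"
    by (rule nn_integral_multc) measurable
  \<comment> \<open>Factor \<open>i\<close> of the shortened rows is factor \<open>Suc i\<close> of
    the full ones, since dropping one entry moves the start of the tail by
    \<open>\<beta>\<close>.\<close>
  also have "(\<Prod>i<N. \<integral>\<^sup>+y. ennreal ((\<Sum>j=\<beta> * i..<?m. (y j)\<^sup>2) powr p) \<partial>\<mu>' (i + Suc k)) =
      (\<Prod>i<N. \<integral>\<^sup>+y. ennreal ((\<Sum>j=\<beta> * Suc i..<?n. (y j)\<^sup>2) powr p) \<partial>\<mu> (Suc i + k))"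
  proof (rule prod.cong)
    fix i assume "i \<in> {..<N}"
    have [measurable]: "(\<lambda>y. \<Sum>j=\<beta> * i..<?m. (y j)\<^sup>2) \<in> borel_measurable (lebesgue_power ?m)"
      by (rule borel_measurable_sum) auto
    have shift: "(\<Sum>j=\<beta> * i..<?m. (drop_coords \<beta> ?m y j)\<^sup>2) = (\<Sum>j=\<beta> * Suc i..<?n. (y j)\<^sup>2)" for y
      using sum.shift_bounds_nat_ivl[of "\<lambda>j. (y j)\<^sup>2" "\<beta> * i" \<beta> ?m]
      by (simp add: drop_coords_def add.commute)
    have "(\<integral>\<^sup>+y. ennreal ((\<Sum>j=\<beta> * i..<?m. (y j)\<^sup>2) powr p) \<partial>\<mu>' (i + Suc k)) =
        (\<integral>\<^sup>+y. ennreal ((\<Sum>j=\<beta> * i..<?m. (drop_coords \<beta> ?m y j)\<^sup>2) powr p) \<partial>\<mu> (i + Suc k))"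
      unfolding \<mu>'_def by (rule nn_integral_distr) measurable
    also have "\<dots> = (\<integral>\<^sup>+y. ennreal ((\<Sum>j=\<beta> * Suc i..<?n. (y j)\<^sup>2) powr p) \<partial>\<mu> (i + Suc k))"
      by (simp only: shift)
    finally show "(\<integral>\<^sup>+y. ennreal ((\<Sum>j=\<beta> * i..<?m. (y j)\<^sup>2) powr p) \<partial>\<mu>' (i + Suc k)) =
        (\<integral>\<^sup>+y. ennreal ((\<Sum>j=\<beta> * Suc i..<?n. (y j)\<^sup>2) powr p) \<partial>\<mu> (Suc i + k))" by simp
  qed simp
  finally show ?case
    by (simp only: prod.lessThan_Suc_shift sq_norm_row_def atLeast0LessThan mult_0_right add_0)
qed

section \<open>Complex and quaternionic Householder reflections\<close>

definition row_inner :: "nat \<Rightarrow> (nat \<Rightarrow> complex) \<Rightarrow> (nat \<Rightarrow> complex) \<Rightarrow> complex" where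
  "row_inner m X W = (\<Sum>k<m. X k * cnj (W k))"

definition row_sq :: "nat \<Rightarrow> (nat \<Rightarrow> complex) \<Rightarrow> real" where
  "row_sq m W = (\<Sum>k<m. (cmod (W k))\<^sup>2)"

definition householder :: "nat \<Rightarrow> (nat \<Rightarrow> complex) \<Rightarrow> (nat \<Rightarrow> complex) \<Rightarrow> nat \<Rightarrow> complex" where
  "householder m W X j = X j - 2 * row_inner m X W / of_real (row_sq m W) * W j"

lemma row_inner_self: "row_inner m W W = of_real (row_sq m W)"
  by (simp add: row_inner_def row_sq_def complex_norm_square[symmetric])

lemma row_sq_nonneg: "row_sq m W \<ge> 0"
  by (simp add: row_sq_def sum_nonneg)

lemma row_sq_eq_0_iff: "row_sq m W = 0 \<longleftrightarrow> (\<forall>k<m. W k = 0)"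
  unfolding row_sq_def by (subst sum_nonneg_eq_0_iff) auto

lemma row_inner_add_right: "row_inner m X (\<lambda>j. W j + Z j) = row_inner m X W + row_inner m X Z"
  by (simp add: row_inner_def sum.distrib algebra_simps)

lemma row_sq_add: "row_sq m (\<lambda>j. Y j + Z j) = row_sq m Y + 2 * Re (row_inner m Y Z) + row_sq m Z"
proof -
  have "(cmod (y + z))\<^sup>2 = (cmod y)\<^sup>2 + 2 * Re (y * cnj z) + (cmod z)\<^sup>2" for y z :: complex
    unfolding cmod_power2 by (simp add: power2_eq_square algebra_simps)
  then show ?thesis
    by (simp add: row_sq_def row_inner_def sum.distrib sum_distrib_left)
qed

text \<open>Reflecting all rows is right multiplication by \<open>H\<close>, the identity minus the
  rank one matrix with entries \<open>u i * W j\<close>. As the pairing of \<open>W\<close> with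
  \<open>u\<close> is 2, or \<open>u\<close> is 0, \<open>H\<close> is an involution and its
  determinant squares to 1.\<close>

lemma det_householder:
  fixes A B :: "complex mat"
  assumes A: "A \<in> carrier_mat m m" and B: "B \<in> carrier_mat m m"
    and AB: "\<And>i j. i < m \<Longrightarrow> j < m \<Longrightarrow> B $$ (i, j) = householder m W (\<lambda>k. A $$ (i, k)) j"
  shows "cmod (Determinant.det B) = cmod (Determinant.det A)"
proof -
  define u where "u = (\<lambda>k. 2 * cnj (W k) / of_real (row_sq m W))"
  define H where "H = Matrix.mat m m (\<lambda>(i, j). (if i = j then 1 else 0) - u i * W j)"
  have H: "H \<in> carrier_mat m m" by (simp add: H_def)
  have uW: "(\<Sum>k<m. W k * u k) = 2 \<or> (\<forall>k. u k = 0)"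
  proof (cases "row_sq m W = 0")
    case False
    have "(\<Sum>k<m. W k * u k) = 2 * row_inner m W W / of_real (row_sq m W)"
      by (simp add: row_inner_def u_def sum_distrib_left sum_divide_distrib mult_ac)
    also have "\<dots> = 2" using False by (simp add: row_inner_self)
    finally show ?thesis ..
  qed (simp add: u_def)
  have "B = A * H"
  proof (rule eq_matI)
    fix i j assume "i < dim_row (A * H)" "j < dim_col (A * H)"
    then have ij: "i < m" "j < m" using A H by auto
    have "(A * H) $$ (i, j) = (\<Sum>k<m. A $$ (i, k) * ((if k = j then 1 else 0) - u k * W j))"
      using A ij by (simp add: H_def scalar_prod_def lessThan_atLeast0)
    also have "\<dots> = (\<Sum>k<m. if k = j then A $$ (i, k) else 0) - (\<Sum>k<m. A $$ (i, k) * u k) * W j"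
      unfolding sum_distrib_right sum_subtractf[symmetric]
      by (intro sum.cong) (auto simp: algebra_simps)
    also have "(\<Sum>k<m. A $$ (i, k) * u k) = 2 * row_inner m (\<lambda>k. A $$ (i, k)) W / of_real (row_sq m W)"
      by (simp add: row_inner_def u_def sum_distrib_left sum_divide_distrib mult_ac)
    finally show "B $$ (i, j) = (A * H) $$ (i, j)"
      using ij by (simp add: AB householder_def)
  qed (use A B H in auto)
  moreover have "H * H = 1\<^sub>m m"
  proof (rule eq_matI)
    fix i j assume "i < dim_row (1\<^sub>m m :: complex mat)" "j < dim_col (1\<^sub>m m :: complex mat)"
    then have ij: "i < m" "j < m" by auto
    have "(H * H) $$ (i, j) =
        (\<Sum>k<m. ((if i = k then 1 else 0) - u i * W k) * ((if k = j then 1 else 0) - u k * W j))"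
      using ij by (simp add: H_def scalar_prod_def lessThan_atLeast0)
    also have "\<dots> = (\<Sum>k<m. (if k = i then (if i = j then 1 else 0) - u i * W j else 0)
        - (if k = j then u i * W j else 0) + u i * W j * (W k * u k))"
      by (rule sum.cong) (auto simp: algebra_simps)
    also have "\<dots> = (if i = j then 1 else 0) - 2 * (u i * W j) + u i * W j * (\<Sum>k<m. W k * u k)"
      using ij by (simp add: sum.distrib sum_subtractf sum_distrib_left)
    also have "\<dots> = (if i = j then 1 else 0)"
      using uW by auto
    finally show "(H * H) $$ (i, j) = 1\<^sub>m m $$ (i, j)" using ij by simp
  qed (use H in auto)
  then have "Determinant.det H * Determinant.det H = 1"
    using det_mult[OF H H] by simp
  then have "cmod (Determinant.det H) * cmod (Determinant.det H) = 1"
    by (simp flip: norm_mult)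
  then have "cmod (Determinant.det H) = 1"
    using square_eq_1_iff[of "cmod (Determinant.det H)"] norm_ge_zero[of "Determinant.det H"] by auto
  ultimately show ?thesis
    using A H by (simp add: det_mult norm_mult)
qed

text \<open>
  Same norm as \<open>Y\<close>, and parallel to its first \<open>d\<close> entries (\<open>d\<close> is the size of the matrix block of
  one entry), so that the reflection in the direction of \<open>Y + pivot d m Y\<close> moves \<open>Y\<close> into them.
\<close>

definition pivot :: "nat \<Rightarrow> nat \<Rightarrow> (nat \<Rightarrow> complex) \<Rightarrow> nat \<Rightarrow> complex" where
  "pivot d m Y j =
     (if j < d then
        if row_sq d Y = 0 then (if j = 0 then of_real (sqrt (row_sq m Y)) else 0)
        else of_real (sqrt (row_sq m Y / row_sq d Y)) * Y j
      else 0)"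

lemma row_sq_pivot:
  assumes "0 < d" "d \<le> k"
  shows "row_sq k (pivot d m Y) = row_sq m Y"
proof -
  have "row_sq k (pivot d m Y) = row_sq d (pivot d m Y)"
    unfolding row_sq_def using assms by (intro sum.mono_neutral_right) (auto simp: pivot_def)
  also have "\<dots> = row_sq m Y"
  proof (cases "row_sq d Y = 0")
    case True
    then have "row_sq d (pivot d m Y) = (\<Sum>j<d. if j = 0 then row_sq m Y else 0)"
      unfolding row_sq_def[of d "pivot d m Y"]
      by (intro sum.cong) (auto simp: pivot_def row_sq_nonneg)
    then show ?thesis using assms by simp
  next
    case False
    then have "row_sq d (pivot d m Y) = (\<Sum>j<d. row_sq m Y / row_sq d Y * (cmod (Y j))\<^sup>2)"
      unfolding row_sq_def[of d "pivot d m Y"]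
      by (intro sum.cong) (auto simp: pivot_def norm_mult power_mult_distrib row_sq_nonneg)
    also have "\<dots> = row_sq m Y / row_sq d Y * row_sq d Y"
      by (simp add: row_sq_def sum_distrib_left)
    finally show ?thesis using False by simp
  qed
  finally show ?thesis .
qed

text \<open>With \<open>q\<close> the squared norm of \<open>Y\<close> and \<open>r\<close> its
  inner product with the pivot, which is real and nonnegative by construction,
  \<open>Y + pivot\<close> has squared norm \<open>2 * (q + r)\<close> and inner product
  \<open>q + r\<close> with \<open>Y\<close>. The coefficient is thus 1, and subtracting
  \<open>Y + pivot\<close> from \<open>Y\<close> leaves minus the pivot. The plus sign ensures that
  \<open>q + r = 0\<close> happens only for \<open>Y = 0\<close>.\<close>

lemma householder_pivot:
  assumes "0 < d" "d \<le> m" "j < m"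
  shows "householder m (\<lambda>j. Y j + pivot d m Y j) Y j = - pivot d m Y j"
proof -
  define q where "q = row_sq m Y"
  define r where "r = sqrt (row_sq m Y / row_sq d Y) * row_sq d Y"
  have qr: "q \<ge> 0" "r \<ge> 0" by (simp_all add: q_def r_def row_sq_nonneg)
  have r: "row_inner m Y (pivot d m Y) = of_real r"
  proof -
    have "row_inner m Y (pivot d m Y) = row_inner d Y (pivot d m Y)"
      unfolding row_inner_def using assms by (intro sum.mono_neutral_right) (auto simp: pivot_def)
    also have "\<dots> = of_real r"
    proof (cases "row_sq d Y = 0")
      case True
      then show ?thesis
        by (auto simp: r_def row_sq_eq_0_iff row_inner_def)
    next
      case False
      then have "row_inner d Y (pivot d m Y) = of_real (sqrt (row_sq m Y / row_sq d Y)) * row_inner d Y Y"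
        by (simp add: row_inner_def pivot_def sum_distrib_left mult_ac)
      then show ?thesis by (simp add: r_def row_inner_self)
    qed
    finally show ?thesis .
  qed
  have sq: "row_sq m (\<lambda>j. Y j + pivot d m Y j) = 2 * (q + r)"
    using assms by (simp add: row_sq_add r row_sq_pivot q_def)
  have ip: "row_inner m Y (\<lambda>j. Y j + pivot d m Y j) = of_real (q + r)"
    by (simp add: row_inner_add_right row_inner_self r q_def)
  show ?thesis
  proof (cases "q + r = 0")
    case True
    then have "q = 0" using qr by linarith
    then have "row_sq m Y = 0" "row_sq m (pivot d m Y) = 0"
      using assms by (simp_all add: q_def row_sq_pivot)
    then show ?thesis
      using assms(3) by (simp add: row_sq_eq_0_iff householder_def)
  next
    case False
    have "2 * complex_of_real t / of_real (2 * t) = 1" if "t \<noteq> 0" for t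
      using that by simp
    from this[OF False] show ?thesis
      unfolding householder_def sq ip by simp
  qed
qed

lemma det_block_pivot:
  fixes B :: "complex mat"
  assumes B: "B \<in> carrier_mat (d + m) (d + m)"
    and zero: "\<And>i j. i < d \<Longrightarrow> d \<le> j \<Longrightarrow> j < d + m \<Longrightarrow> B $$ (i, j) = 0"
  shows "Determinant.det B = Determinant.det (Matrix.mat d d (\<lambda>(i, j). B $$ (i, j))) *
    Determinant.det (Matrix.mat m m (\<lambda>(i, j). B $$ (i + d, j + d)))"
proof -
  let ?A1 = "Matrix.mat d d (\<lambda>(i, j). B $$ (i, j))"
  let ?A3 = "Matrix.mat m d (\<lambda>(i, j). B $$ (i + d, j))"
  let ?A4 = "Matrix.mat m m (\<lambda>(i, j). B $$ (i + d, j + d))"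
  have "B = four_block_mat ?A1 (0\<^sub>m d m) ?A3 ?A4"
    using B zero by (intro eq_matI) (auto simp: not_less)
  then show ?thesis
    using det_four_block_mat_upper_right_zero[of ?A1 d "0\<^sub>m d m" m ?A3 ?A4] by simp
qed

section \<open>Gram determinants as squared moduli of determinants\<close>

lemma gram_det_complex:
  fixes A :: "complex mat"
  assumes A: "A \<in> carrier_mat m m"
  shows "gram_det A = of_real ((cmod (Determinant.det A))\<^sup>2)"
proof -
  interpret cnj: comm_ring_hom cnj by standard auto
  have "mat_adjoint A = transpose_mat (map_mat cnj A)"
    using A by (intro eq_matI) (auto simp: mat_adjoint_def mat_of_rows_def)
  moreover have "Determinant.det (transpose_mat (map_mat cnj A)) = cnj (Determinant.det A)"
    using A by (subst det_transpose[of _ m]) (auto simp: cnj.hom_det)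
  ultimately have "gram_det A = cnj (Determinant.det A) * Determinant.det A"
    unfolding gram_det_def using A by (subst det_mult[of _ m]) auto
  then show ?thesis by (simp add: complex_norm_square[symmetric] mult.commute del: of_real_power)
qed

text \<open>Passing to the complex matrix lets the real case share the complex Householder
  argument.\<close>

lemma gram_det_real:
  fixes A :: "real mat"
  assumes A: "A \<in> carrier_mat m m"
  shows "gram_det A = (cmod (Determinant.det (map_mat of_real A)))\<^sup>2"
proof -
  have "mat_adjoint A = transpose_mat A"
    using A by (intro eq_matI) (auto simp: mat_adjoint_def mat_of_rows_def)
  then have "gram_det A = Determinant.det A * Determinant.det A"
    unfolding gram_det_def using A by (subst det_mult[of _ m]) (auto simp: det_transpose)
  then show ?thesis by (simp add: power2_eq_square[symmetric])
qed

section \<open>Real coordinates of complex and quaternionic rows\<close>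

definition complex_row :: "(nat \<Rightarrow> real) \<Rightarrow> nat \<Rightarrow> complex" where
  "complex_row y j = Complex (y (2 * j)) (y (2 * j + 1))"

definition real_coords :: "(nat \<Rightarrow> complex) \<Rightarrow> nat \<Rightarrow> real" where
  "real_coords X k = (if even k then Re (X (k div 2)) else Im (X (k div 2)))"

text \<open>\<open>quat_j X\<close> is the second row of the \<open>2 \<times> 2\<close> blocks whose first row is \<open>X\<close>.\<close>

definition quat_j :: "(nat \<Rightarrow> complex) \<Rightarrow> nat \<Rightarrow> complex" where
  "quat_j X j = (if even j then - cnj (X (j + 1)) else cnj (X (j - 1)))"

lemma sum_pairs:
  fixes f :: "nat \<Rightarrow> 'a :: comm_monoid_add"
  shows "(\<Sum>j<2 * m. f j) = (\<Sum>j<m. f (2 * j) + f (2 * j + 1))"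
  by (induction m) (simp_all add: add.assoc)

lemma complex_row_real_coords [simp]: "complex_row (real_coords X) = X"
  by (simp add: complex_row_def real_coords_def fun_eq_iff complex_eq_iff)

lemma row_sq_two: "complex_of_real (row_sq 2 Z) = Z 0 * cnj (Z 0) + Z 1 * cnj (Z 1)"
  by (simp add: row_inner_self[symmetric] row_inner_def numeral_2_eq_2)

lemma row_sq_complex_row: "row_sq m (complex_row y) = sq_norm_row (2 * m) y"
  by (simp add: row_sq_def sq_norm_row_def complex_row_def sum_pairs cmod_power2)

lemma householder_cong: "(\<And>j. j < m \<Longrightarrow> X j = X' j) \<Longrightarrow> j < m \<Longrightarrow> householder m W X j = householder m W X' j"
  by (simp add: householder_def row_inner_def)

lemma householder_real:
  assumes "j < m"
  shows "householder m (\<lambda>j. of_real (w j)) (\<lambda>j. of_real (y j)) j = of_real (reflect m w y j)"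
  using assms by (simp add: householder_def row_inner_def row_sq_def reflect_def)

text \<open>As real vectors, \<open>W\<close> and \<open>\<i> * W\<close> are orthogonal and of
  equal length. The two real reflections subtract the real and the imaginary part of the complex
  coefficient, and the first leaves the component along \<open>\<i> * W\<close> unchanged.\<close>

lemma householder_complex_row:
  assumes "j < m"
  shows "complex_row (fold (reflect (2 * m)) [real_coords W, real_coords (\<lambda>j. \<i> * W j)] y) j = householder m W (complex_row y) j"
proof -
  let ?w = "real_coords W" and ?v = "real_coords (\<lambda>j. \<i> * W j)"
  define S where "S = row_sq m W"
  have w: "(\<Sum>j<2 * m. x j * ?w j) = Re (row_inner m (complex_row x) W)"
    and v: "(\<Sum>j<2 * m. x j * ?v j) = Im (row_inner m (complex_row x) W)" for x
    unfolding sum_pairs row_inner_def Re_sum Im_sum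
    by (auto intro!: sum.cong simp: complex_row_def real_coords_def algebra_simps)
  have S: "(\<Sum>j<2 * m. (?w j)\<^sup>2) = S" "(\<Sum>j<2 * m. (?v j)\<^sup>2) = S"
    by (simp_all add: S_def sum_pairs row_sq_def real_coords_def cmod_power2 add.commute)
  define a b where "a = 2 * Re (row_inner m (complex_row y) W) / S" and "b = 2 * Im (row_inner m (complex_row y) W) / S"
  define y' where "y' = reflect (2 * m) ?w y"
  have y': "y' k = y k - a * ?w k" if "k < 2 * m" for k
    using that by (simp add: y'_def reflect_def w S a_def)
  have "(\<Sum>j<2 * m. y' j * ?v j) = (\<Sum>j<2 * m. y j * ?v j) - a * (\<Sum>j<2 * m. ?w j * ?v j)"
    by (simp add: y' sum_subtractf sum_distrib_left algebra_simps)
  also have "\<dots> = Im (row_inner m (complex_row y) W)"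
    unfolding v by (simp add: row_inner_self)
  finally have r: "reflect (2 * m) ?v y' k = y k - a * ?w k - b * ?v k" if "k < 2 * m" for k
    using that y'[OF that] by (simp add: reflect_def S b_def)
  have "complex_row (reflect (2 * m) ?v y') j = complex_row y j - (of_real a + \<i> * of_real b) * W j"
    unfolding complex_row_def using assms r[of "2 * j"] r[of "2 * j + 1"]
    by (simp add: real_coords_def complex_eq_iff algebra_simps)
  also have "of_real a + \<i> * of_real b = 2 * row_inner m (complex_row y) W / of_real S"
    by (simp add: a_def b_def complex_eq_iff)
  finally show ?thesis by (simp add: y'_def householder_def S_def)
qed

section \<open>The antilinear quaternionic structure and reflections commuting with it\<close>

lemma quat_j_quat_j: "quat_j (quat_j X) j = - X j"
  by (auto simp: quat_j_def elim!: oddE evenE)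

lemma quat_j_add: "quat_j (\<lambda>j. X j + W j) = (\<lambda>j. quat_j X j + quat_j W j)"
  by (simp add: quat_j_def fun_eq_iff)

lemma row_inner_quat_j: "row_inner (2 * n) (quat_j X) (quat_j W) = cnj (row_inner (2 * n) X W)"
  by (simp add: row_inner_def sum_pairs quat_j_def add.commute)

lemma row_sq_quat_j: "row_sq (2 * n) (quat_j W) = row_sq (2 * n) W"
  by (simp add: row_sq_def sum_pairs quat_j_def add.commute)

lemma row_inner_quat_j_left: "row_inner (2 * n) (quat_j X) W = - cnj (row_inner (2 * n) X (quat_j W))"
  by (simp add: row_inner_def sum_pairs quat_j_def flip: sum_negf)

lemma row_inner_quat_j_self: "row_inner (2 * n) W (quat_j W) = 0"
  unfolding row_inner_def sum_pairs by (simp add: quat_j_def mult.commute)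

text \<open>\<open>W\<close> and \<open>quat_j W\<close> are orthogonal, so the second reflection
  meets the original coefficient. Together they negate the complex plane spanned by both vectors,
  which is the quaternionic line of \<open>W\<close>, and fix its orthogonal complement.\<close>

lemma householder_householder_quat_j:
  "householder (2 * n) (quat_j W) (householder (2 * n) W X) j =
    X j - 2 * row_inner (2 * n) X W / of_real (row_sq (2 * n) W) * W j
      - 2 * row_inner (2 * n) X (quat_j W) / of_real (row_sq (2 * n) W) * quat_j W j"
proof -
  let ?c = "2 * row_inner (2 * n) X W / of_real (row_sq (2 * n) W)"
  have "row_inner (2 * n) (householder (2 * n) W X) (quat_j W) =
      row_inner (2 * n) X (quat_j W) - ?c * row_inner (2 * n) W (quat_j W)"
    unfolding row_inner_def[of "2 * n" _ "quat_j W"] householder_def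
    by (simp add: sum_subtractf sum_distrib_left left_diff_distrib mult.assoc)
  then have "row_inner (2 * n) (householder (2 * n) W X) (quat_j W) = row_inner (2 * n) X (quat_j W)"
    by (simp add: row_inner_quat_j_self)
  then show ?thesis
    unfolding householder_def[of "2 * n" "quat_j W"] row_sq_quat_j by (simp add: householder_def)
qed

text \<open>The plane spanned by \<open>W\<close> and \<open>quat_j W\<close> is stable under
  \<open>quat_j\<close>; a single complex reflection would not respect the pairing of rows.\<close>

lemma householder_householder_quat_j_commute:
  "householder (2 * n) (quat_j W) (householder (2 * n) W (quat_j X)) j =
    quat_j (householder (2 * n) (quat_j W) (householder (2 * n) W X)) j"
proof -
  define a b where "a = 2 * row_inner (2 * n) X W / of_real (row_sq (2 * n) W)"
    and "b = 2 * row_inner (2 * n) X (quat_j W) / of_real (row_sq (2 * n) W)"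
  have "householder (2 * n) (quat_j W) (householder (2 * n) W X) = (\<lambda>j. X j - a * W j - b * quat_j W j)"
    by (simp add: fun_eq_iff householder_householder_quat_j a_def b_def)
  then have "quat_j (householder (2 * n) (quat_j W) (householder (2 * n) W X)) j =
      quat_j X j - cnj a * quat_j W j - cnj b * quat_j (quat_j W) j"
    by (simp add: quat_j_def)
  also have "\<dots> = quat_j X j + cnj b * W j - cnj a * quat_j W j"
    by (simp add: quat_j_quat_j)
  finally show ?thesis
    unfolding householder_householder_quat_j[of n W "quat_j X"] row_inner_quat_j row_inner_quat_j_left[of n X W]
    by (simp add: a_def b_def)
qed

text \<open>On the first two entries either the pivot is a real multiple of \<open>Y\<close>, and a
  single quaternion is already orthogonal to its image under \<open>quat_j\<close>, or
  \<open>Y\<close> and with it \<open>quat_j Y\<close> vanish there.\<close>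

lemma row_inner_pivot_quat_j: "row_inner (2 * Suc n) (pivot 2 (2 * Suc n) Y) (quat_j Y) = 0"
proof -
  let ?m = "2 * Suc n" and ?Z = "pivot 2 (2 * Suc n) Y"
  have "row_inner ?m ?Z (quat_j Y) = row_inner 2 ?Z (quat_j Y)"
    unfolding row_inner_def by (intro sum.mono_neutral_right) (auto simp: pivot_def)
  also have "\<dots> = 0"
  proof (cases "row_sq 2 Y = 0")
    case True
    then show ?thesis
      by (simp add: row_inner_def row_sq_eq_0_iff quat_j_def numeral_2_eq_2)
  next
    case False
    then have "row_inner 2 ?Z (quat_j Y) = of_real (sqrt (row_sq ?m Y / row_sq 2 Y)) * row_inner 2 Y (quat_j Y)"
      by (simp add: row_inner_def pivot_def sum_distrib_left mult.assoc)
    then show ?thesis using row_inner_quat_j_self[of 1 Y] by simp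
  qed
  finally show ?thesis .
qed

text \<open>The first reflection already sends \<open>Y\<close> to \<open>- Z\<close>. The second
  fixes this vector, because \<open>Z\<close> is orthogonal to \<open>quat_j Y\<close> and to
  \<open>quat_j Z\<close>, hence to \<open>quat_j W\<close>.\<close>

lemma householder_householder_pivot:
  fixes Y :: "nat \<Rightarrow> complex" and n :: nat
  defines "Z \<equiv> pivot 2 (2 * Suc n) Y"
  defines "W \<equiv> \<lambda>j. Y j + Z j"
  assumes "j < 2 * Suc n"
  shows "householder (2 * Suc n) (quat_j W) (householder (2 * Suc n) W Y) j = - Z j"
proof -
  let ?m = "2 * Suc n"
  have "householder ?m (quat_j W) (householder ?m W Y) j = householder ?m (quat_j W) (\<lambda>j. - Z j) j"
  proof (rule householder_cong)
    fix k assume "k < ?m"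
    then show "householder ?m W Y k = - Z k"
      unfolding W_def Z_def by (intro householder_pivot) auto
  qed fact
  moreover have "row_inner ?m (\<lambda>j. - Z j) (quat_j W) = - (row_inner ?m Z (quat_j Y) + row_inner ?m Z (quat_j Z))"
    unfolding W_def quat_j_add by (simp only: row_inner_add_right[symmetric]) (simp add: row_inner_def sum_negf)
  moreover have "row_inner ?m Z (quat_j Y) = 0" unfolding Z_def by (rule row_inner_pivot_quat_j)
  moreover have "row_inner ?m Z (quat_j Z) = 0" by (rule row_inner_quat_j_self)
  ultimately show ?thesis by (simp add: householder_def)
qed

lemma det_two_by_two:
  fixes A :: "'a :: comm_ring_1 mat"
  assumes A: "A \<in> carrier_mat 2 2"
  shows "Determinant.det A = A $$ (0, 0) * A $$ (1, 1) - A $$ (0, 1) * A $$ (1, 0)"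
proof -
  have minor: "Determinant.det (mat_delete A 0 j) = mat_delete A 0 j $$ (0, 0)" for j
    by (rule det_single) (use mat_delete_carrier[OF A, of 0 j] in simp)
  have "Determinant.det A = (\<Sum>j<2. A $$ (0, j) * cofactor A 0 j)"
    by (rule laplace_expansion_row[OF A]) simp
  also have "\<dots> = A $$ (0, 0) * cofactor A 0 0 + A $$ (0, 1) * cofactor A 0 1"
    by (simp add: lessThan_Suc numeral_2_eq_2 add.commute)
  also have "cofactor A 0 0 = A $$ (1, 1)"
    using A unfolding cofactor_def minor by (simp add: mat_delete_def)
  also have "cofactor A 0 1 = - A $$ (1, 0)"
    using A unfolding cofactor_def minor by (simp add: mat_delete_def)
  finally show ?thesis by simp
qed

section \<open>Splitting the first row off the determinant\<close>

lemma det_peel_row: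
  fixes R :: "nat \<Rightarrow> nat \<Rightarrow> complex" and N :: nat
  defines "W \<equiv> \<lambda>j. R 0 j + pivot 1 (Suc N) (R 0) j"
  shows "(cmod (Determinant.det (Matrix.mat (Suc N) (Suc N) (\<lambda>(i, j). R i j))))\<^sup>2 =
    row_sq (Suc N) (R 0) *
    (cmod (Determinant.det (Matrix.mat N N (\<lambda>(i, j). householder (Suc N) W (R (Suc i)) (Suc j)))))\<^sup>2"
proof -
  let ?A = "Matrix.mat (Suc N) (Suc N) (\<lambda>(i, j). R i j)"
  let ?Z = "pivot 1 (Suc N) (R 0)"
  define B where "B = Matrix.mat (Suc N) (Suc N) (\<lambda>(i, j). householder (Suc N) W (R i) j)"
  have B: "B \<in> carrier_mat (Suc N) (Suc N)" by (simp add: B_def)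
  have row: "B $$ (0, j) = - ?Z j" if "j < Suc N" for j
    using that householder_pivot[of 1 "Suc N" j "R 0"] by (simp add: B_def W_def)
  have "cmod (Determinant.det ?A) = cmod (Determinant.det B)"
    by (rule det_householder[symmetric, of _ "Suc N" _ W])
      (auto simp: B_def intro!: householder_cong)
  also have "Determinant.det B = Determinant.det (Matrix.mat 1 1 (\<lambda>(i, j). B $$ (i, j))) *
      Determinant.det (Matrix.mat N N (\<lambda>(i, j). B $$ (i + 1, j + 1)))"
    using B row by (intro det_block_pivot) (auto simp: pivot_def)
  also have "Determinant.det (Matrix.mat 1 1 (\<lambda>(i, j). B $$ (i, j))) = - ?Z 0"
    using row[of 0] by (subst det_single) auto
  also have "Matrix.mat N N (\<lambda>(i, j). B $$ (i + 1, j + 1)) =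
      Matrix.mat N N (\<lambda>(i, j). householder (Suc N) W (R (Suc i)) (Suc j))"
    by (intro eq_matI) (auto simp: B_def)
  finally have "cmod (Determinant.det ?A) = cmod (?Z 0) *
      cmod (Determinant.det (Matrix.mat N N (\<lambda>(i, j). householder (Suc N) W (R (Suc i)) (Suc j))))"
    by (simp add: norm_mult)
  moreover have "(cmod (?Z 0))\<^sup>2 = row_sq (Suc N) (R 0)"
    using row_sq_pivot[of 1 1 "Suc N" "R 0"] by (simp add: row_sq_def)
  ultimately show ?thesis by (simp add: power_mult_distrib)
qed

text \<open>Row \<open>2 * i + a\<close> of the complex matrix is row \<open>a\<close> of the blocks
  of quaternionic row \<open>i\<close>. The second is determined by the first, so one complex row
  encodes a quaternionic row.\<close>

definition quat_row :: "(nat \<Rightarrow> nat \<Rightarrow> complex) \<Rightarrow> nat \<Rightarrow> nat \<Rightarrow> complex" where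
  "quat_row R i = (if even i then R (i div 2) else quat_j (R (i div 2)))"

text \<open>The corner that splits off is the block of a single quaternion, whose determinant is its
  squared norm. This is why \<open>cmod\<close> is not squared here, unlike in
  \<open>det_peel_row\<close>.\<close>

lemma det_peel_quaternion_row:
  fixes R :: "nat \<Rightarrow> nat \<Rightarrow> complex" and N :: nat
  defines "m \<equiv> 2 * Suc N"
  defines "W \<equiv> \<lambda>j. R 0 j + pivot 2 m (R 0) j"
  shows "cmod (Determinant.det (Matrix.mat m m (\<lambda>(i, j). quat_row R i j))) =
    row_sq m (R 0) * cmod (Determinant.det (Matrix.mat (2 * N) (2 * N)
      (\<lambda>(i, j). quat_row (\<lambda>i. householder m (quat_j W) (householder m W (R (Suc i)))) i (j + 2))))"
proof -
  let ?A = "Matrix.mat m m (\<lambda>(i, j). quat_row R i j)"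
  let ?Z = "pivot 2 m (R 0)"
  define T where "T = (\<lambda>X. householder m (quat_j W) (householder m W X))"
  define B1 where "B1 = Matrix.mat m m (\<lambda>(i, j). householder m W (quat_row R i) j)"
  define B where "B = Matrix.mat m m (\<lambda>(i, j). T (quat_row R i) j)"
  have B: "B \<in> carrier_mat (2 + 2 * N) (2 + 2 * N)" by (simp add: B_def m_def)
  have T_quat: "T (quat_row R i) = quat_row (\<lambda>i. T (R i)) i" for i
    by (cases "even i") (simp_all only: quat_row_def T_def m_def fun_eq_iff householder_householder_quat_j_commute if_True if_False simp_thms)
  have B_eq: "B $$ (i, j) = quat_row (\<lambda>i. T (R i)) i j" if "i < m" "j < m" for i j
    using that by (simp add: B_def flip: T_quat)
  have row0: "T (R 0) j = - ?Z j" if "j < m" for j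
    using that householder_householder_pivot[of j N "R 0"] by (simp add: T_def W_def m_def)
  have row1: "quat_j (T (R 0)) j = - quat_j ?Z j" if "j < m" for j
  proof -
    \<comment> \<open>\<open>quat_j\<close> reads the partner column \<open>j + 1\<close>; it stays
      in range because \<open>m\<close> is even.\<close>
    have "j + 1 < m" if "even j" using \<open>j < m\<close> that unfolding m_def by presburger
    then show ?thesis using that by (simp add: quat_j_def row0)
  qed
  have zero: "B $$ (i, j) = 0" if "i < 2" "2 \<le> j" "j < 2 + 2 * N" for i j
  proof -
    have "j < m" using that by (simp add: m_def)
    moreover have "i = 0 \<or> i = 1" using that by auto
    moreover have "quat_j ?Z j = 0"
    proof -
      have "j - 1 \<ge> 2" if "odd j" using that \<open>2 \<le> j\<close> by presburger
      then show ?thesis using \<open>2 \<le> j\<close> by (auto simp: quat_j_def pivot_def)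
    qed
    moreover have "?Z j = 0" using \<open>2 \<le> j\<close> by (simp add: pivot_def)
    moreover have "1 < m" by (simp add: m_def)
    ultimately show ?thesis
      by (auto simp: B_eq quat_row_def row0 row1)
  qed
  have "cmod (Determinant.det ?A) = cmod (Determinant.det B1)"
    by (rule det_householder[symmetric, of _ m _ W]) (auto simp: B1_def intro!: householder_cong)
  also have "\<dots> = cmod (Determinant.det B)"
    by (rule det_householder[symmetric, of _ m _ "quat_j W"]) (auto simp: B1_def B_def T_def intro!: householder_cong)
  also have "Determinant.det B = Determinant.det (Matrix.mat 2 2 (\<lambda>(i, j). B $$ (i, j))) *
      Determinant.det (Matrix.mat (2 * N) (2 * N) (\<lambda>(i, j). B $$ (i + 2, j + 2)))"
    using B zero by (rule det_block_pivot)
  also have "Determinant.det (Matrix.mat 2 2 (\<lambda>(i, j). B $$ (i, j))) = of_real (row_sq m (R 0))"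
  proof -
    have "Determinant.det (Matrix.mat 2 2 (\<lambda>(i, j). B $$ (i, j))) =
        B $$ (0, 0) * B $$ (1, 1) - B $$ (0, 1) * B $$ (1, 0)"
      by (subst det_two_by_two) auto
    also have "\<dots> = of_real (row_sq 2 ?Z)"
    proof -
      have "0 < m" "1 < m" by (simp_all add: m_def)
      then show ?thesis
        unfolding row_sq_two by (simp add: B_eq quat_row_def row0 row1) (simp add: quat_j_def algebra_simps)
    qed
    finally show ?thesis
      using row_sq_pivot[of 2 2 m "R 0"] by simp
  qed
  also have "Matrix.mat (2 * N) (2 * N) (\<lambda>(i, j). B $$ (i + 2, j + 2)) =
      Matrix.mat (2 * N) (2 * N) (\<lambda>(i, j). quat_row (\<lambda>i. T (R (Suc i))) i (j + 2))"
    by (intro eq_matI) (auto simp: B_eq quat_row_def m_def)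
  finally show ?thesis
    by (simp add: norm_mult row_sq_nonneg T_def)
qed

section \<open>Moments and logarithm of the determinant\<close>

text \<open>\<open>ws\<close> is quantified before \<open>Y\<close>: it depends on the first row
  only, so the other rows can be integrated with \<open>ws\<close> fixed. In the real case the pivot
  is real, and the complex reflection restricts to one real reflection.\<close>

lemma exists_reflections_real:
  "\<exists>ws. \<forall>Y. Y 0 = y \<longrightarrow>
    (cmod (Determinant.det (Matrix.mat (Suc N) (Suc N) (\<lambda>(i, j). complex_of_real (Y i j)))))\<^sup>2 =
    sq_norm_row (Suc N) y *
    (cmod (Determinant.det (Matrix.mat N N (\<lambda>(i, j). complex_of_real
      (drop_coords 1 N (fold (reflect (Suc N)) ws (Y (Suc i))) j)))))\<^sup>2"
proof -
  define w where "w = (\<lambda>j. y j + Re (pivot 1 (Suc N) (\<lambda>j. complex_of_real (y j)) j))"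
  have w: "complex_of_real (w j) = of_real (y j) + pivot 1 (Suc N) (\<lambda>j. complex_of_real (y j)) j" for j
    by (simp add: w_def pivot_def)
  have row_sq: "row_sq (Suc N) (\<lambda>j. complex_of_real (y j)) = sq_norm_row (Suc N) y"
    by (simp add: row_sq_def sq_norm_row_def)
  show ?thesis
  proof (intro exI[of _ "[w]"] allI impI)
    fix Y :: "nat \<Rightarrow> nat \<Rightarrow> real" assume Y: "Y 0 = y"
    have "Matrix.mat N N (\<lambda>(i, j). householder (Suc N) (\<lambda>j. complex_of_real (w j)) (\<lambda>j. complex_of_real (Y (Suc i) j)) (Suc j)) =
        Matrix.mat N N (\<lambda>(i, j). complex_of_real (drop_coords 1 N (fold (reflect (Suc N)) [w] (Y (Suc i))) j))"
      by (intro eq_matI) (simp_all add: householder_real drop_coords_def)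
    then show "(cmod (Determinant.det (Matrix.mat (Suc N) (Suc N) (\<lambda>(i, j). complex_of_real (Y i j)))))\<^sup>2 =
        sq_norm_row (Suc N) y * (cmod (Determinant.det (Matrix.mat N N (\<lambda>(i, j). complex_of_real
          (drop_coords 1 N (fold (reflect (Suc N)) [w] (Y (Suc i))) j)))))\<^sup>2"
      unfolding det_peel_row[of N "\<lambda>i j. complex_of_real (Y i j)"] by (simp only: Y row_sq w[symmetric])
  qed
qed

lemma exists_reflections_complex:
  "\<exists>ws. \<forall>Y. Y 0 = y \<longrightarrow>
    (cmod (Determinant.det (Matrix.mat (Suc N) (Suc N) (\<lambda>(i, j). complex_row (Y i) j))))\<^sup>2 =
    sq_norm_row (2 * Suc N) y *
    (cmod (Determinant.det (Matrix.mat N N (\<lambda>(i, j).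
      complex_row (drop_coords 2 (2 * N) (fold (reflect (2 * Suc N)) ws (Y (Suc i)))) j))))\<^sup>2"
proof -
  define W where "W = (\<lambda>j. complex_row y j + pivot 1 (Suc N) (complex_row y) j)"
  let ?ws = "[real_coords W, real_coords (\<lambda>j. \<i> * W j)]"
  show ?thesis
  proof (intro exI[of _ ?ws] allI impI)
    fix Y :: "nat \<Rightarrow> nat \<Rightarrow> real" assume Y: "Y 0 = y"
    have "householder (Suc N) W (complex_row (Y (Suc i))) (Suc j) =
        complex_row (drop_coords 2 (2 * N) (fold (reflect (2 * Suc N)) ?ws (Y (Suc i)))) j" if "j < N" for i j
    proof -
      have "complex_row (drop_coords 2 (2 * N) z) j = complex_row z (Suc j)" for z
        using that by (simp add: complex_row_def drop_coords_def)
      then show ?thesis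
        using that householder_complex_row[of "Suc j" "Suc N" W "Y (Suc i)"] by simp
    qed
    then have "Matrix.mat N N (\<lambda>(i, j). householder (Suc N) W (complex_row (Y (Suc i))) (Suc j)) =
        Matrix.mat N N (\<lambda>(i, j). complex_row (drop_coords 2 (2 * N) (fold (reflect (2 * Suc N)) ?ws (Y (Suc i)))) j)"
      by (intro eq_matI) simp_all
    then show "(cmod (Determinant.det (Matrix.mat (Suc N) (Suc N) (\<lambda>(i, j). complex_row (Y i) j))))\<^sup>2 =
        sq_norm_row (2 * Suc N) y * (cmod (Determinant.det (Matrix.mat N N (\<lambda>(i, j).
          complex_row (drop_coords 2 (2 * N) (fold (reflect (2 * Suc N)) ?ws (Y (Suc i)))) j))))\<^sup>2"
      unfolding det_peel_row[of N "\<lambda>i. complex_row (Y i)"] by (simp only: Y W_def row_sq_complex_row)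
  qed
qed

text \<open>Four real reflections, in the directions \<open>W\<close>, \<open>\<i> * W\<close>,
  \<open>quat_j W\<close> and \<open>\<i> * quat_j W\<close>, that is, one for each real dimension
  of the quaternionic line of \<open>W\<close>.\<close>

lemma exists_reflections_quaternion:
  "\<exists>ws. \<forall>Y. Y 0 = y \<longrightarrow>
    cmod (Determinant.det (Matrix.mat (2 * Suc N) (2 * Suc N) (\<lambda>(i, j). quat_row (\<lambda>i. complex_row (Y i)) i j))) =
    sq_norm_row (4 * Suc N) y *
    cmod (Determinant.det (Matrix.mat (2 * N) (2 * N) (\<lambda>(i, j). quat_row (\<lambda>i.
      complex_row (drop_coords 4 (4 * N) (fold (reflect (4 * Suc N)) ws (Y (Suc i))))) i j)))"
proof -
  define m where "m = 2 * Suc N"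
  have m4: "4 * Suc N = 2 * m" by (simp add: m_def)
  define W where "W = (\<lambda>j. complex_row y j + pivot 2 m (complex_row y) j)"
  let ?ws1 = "[real_coords W, real_coords (\<lambda>j. \<i> * W j)]"
  let ?ws2 = "[real_coords (quat_j W), real_coords (\<lambda>j. \<i> * quat_j W j)]"
  let ?ws = "?ws1 @ ?ws2"
  show ?thesis
  proof (intro exI[of _ ?ws] allI impI)
    fix Y :: "nat \<Rightarrow> nat \<Rightarrow> real" assume Y: "Y 0 = y"
    have T: "householder m (quat_j W) (householder m W (complex_row z)) j = complex_row (fold (reflect (2 * m)) ?ws z) j" if "j < m" for z j
    proof -
      have "householder m (quat_j W) (householder m W (complex_row z)) j = householder m (quat_j W) (complex_row (fold (reflect (2 * m)) ?ws1 z)) j"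
        using that by (intro householder_cong householder_complex_row[symmetric])
      also have "\<dots> = complex_row (fold (reflect (2 * m)) ?ws2 (fold (reflect (2 * m)) ?ws1 z)) j"
        using that by (rule householder_complex_row[symmetric])
      finally show ?thesis by simp
    qed
    have drop: "complex_row (drop_coords 4 (4 * N) z) j = complex_row z (j + 2)" if "j < 2 * N" for z j
      using that by (simp add: complex_row_def drop_coords_def eval_nat_numeral)
    define F where "F = (\<lambda>z. householder m (quat_j W) (householder m W (complex_row z)))"
    define G where "G = (\<lambda>z. complex_row (drop_coords 4 (4 * N) (fold (reflect (4 * Suc N)) ?ws z)))"
    have FG: "F z (j + 2) = G z j" if "j < 2 * N" for z j
      using that unfolding F_def G_def m4 by (subst T) (simp_all only: drop, simp add: m_def)
    \<comment> \<open>A shift by two columns respects the pairs that \<open>quat_j\<close>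
      exchanges; \<open>j - 1\<close> occurs only for odd \<open>j\<close>, where the subtraction is
      exact.\<close>
    have quat_FG: "quat_j (F z) (j + 2) = quat_j (G z) j" if "j < 2 * N" for z j
    proof (cases "even j")
      case True
      then have "j + 1 < 2 * N" using that by (auto elim!: evenE)
      from FG[OF this, of z] show ?thesis using True by (simp add: quat_j_def)
    next
      case False
      then have "j - 1 < 2 * N" "j - 1 + 2 = j + 2 - 1" using that by (auto elim!: oddE)
      with FG[of "j - 1" z] show ?thesis using False by (simp only: quat_j_def) simp
    qed
    have "quat_row (\<lambda>i. householder m (quat_j W) (householder m W (complex_row (Y (Suc i))))) i (j + 2) =
        quat_row (\<lambda>i. complex_row (drop_coords 4 (4 * N) (fold (reflect (4 * Suc N)) ?ws (Y (Suc i))))) i j"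
      if "i < 2 * N" "j < 2 * N" for i j
      using FG[OF that(2)] quat_FG[OF that(2)]
      by (cases "even i") (simp_all only: quat_row_def F_def G_def if_True if_False)
    then have "Matrix.mat (2 * N) (2 * N) (\<lambda>(i, j). quat_row (\<lambda>i. householder m (quat_j W) (householder m W (complex_row (Y (Suc i))))) i (j + 2)) =
        Matrix.mat (2 * N) (2 * N) (\<lambda>(i, j). quat_row (\<lambda>i. complex_row (drop_coords 4 (4 * N) (fold (reflect (4 * Suc N)) ?ws (Y (Suc i))))) i j)"
      by (intro eq_matI) simp_all
    then show "cmod (Determinant.det (Matrix.mat (2 * Suc N) (2 * Suc N) (\<lambda>(i, j). quat_row (\<lambda>i. complex_row (Y i)) i j))) =
        sq_norm_row (4 * Suc N) y * cmod (Determinant.det (Matrix.mat (2 * N) (2 * N) (\<lambda>(i, j). quat_row (\<lambda>i.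
          complex_row (drop_coords 4 (4 * N) (fold (reflect (4 * Suc N)) ?ws (Y (Suc i))))) i j)))"
      unfolding det_peel_quaternion_row[of N "\<lambda>i. complex_row (Y i)"] m4 by (simp only: Y W_def row_sq_complex_row m_def)
  qed
qed

text \<open>The square of \<open>abs_det\<close>, with rows counted from 0 as the induction
  requires. The modulus of the quaternionic \<open>2N\<close>-dimensional determinant is already
  this square, hence no exponent in the last case.\<close>

definition sq_det :: "nat \<Rightarrow> nat \<Rightarrow> (nat \<Rightarrow> nat \<Rightarrow> real) \<Rightarrow> real" where
  "sq_det \<beta> N Y =
     (if \<beta> = 1 then (cmod (Determinant.det (Matrix.mat N N (\<lambda>(i, j). complex_of_real (Y i j)))))\<^sup>2
      else if \<beta> = 2 then (cmod (Determinant.det (Matrix.mat N N (\<lambda>(i, j). complex_row (Y i) j))))\<^sup>2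
      else cmod (Determinant.det (Matrix.mat (2 * N) (2 * N) (\<lambda>(i, j). quat_row (\<lambda>i. complex_row (Y i)) i j))))"

lemma abs_det_eq: "abs_det \<beta> N Y = sqrt (sq_det \<beta> N (\<lambda>i. Y (Suc i)))"
proof -
  have "map_mat complex_of_real (real_matrix N Y) = Matrix.mat N N (\<lambda>(i, j). complex_of_real (Y (Suc i) j))"
    by (intro eq_matI) (auto simp: real_matrix_def)
  moreover have "real_matrix N Y \<in> carrier_mat N N" by (simp add: real_matrix_def)
  ultimately have 1: "gram_det (real_matrix N Y) =
      (cmod (Determinant.det (Matrix.mat N N (\<lambda>(i, j). complex_of_real (Y (Suc i) j)))))\<^sup>2"
    by (metis gram_det_real)
  have "complex_matrix N Y = Matrix.mat N N (\<lambda>(i, j). complex_row (Y (Suc i)) j)"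
    by (simp add: complex_matrix_def complex_row_def)
  then have 2: "gram_det (complex_matrix N Y) =
      of_real ((cmod (Determinant.det (Matrix.mat N N (\<lambda>(i, j). complex_row (Y (Suc i)) j))))\<^sup>2)"
    by (metis gram_det_complex mat_carrier)
  have "quaternion_matrix N Y = Matrix.mat (2 * N) (2 * N) (\<lambda>(i, j). quat_row (\<lambda>i. complex_row (Y (Suc i))) i j)"
  proof (intro eq_matI)
    fix i j assume "i < dim_row (Matrix.mat (2 * N) (2 * N) (\<lambda>(i, j). quat_row (\<lambda>i. complex_row (Y (Suc i))) i j))"
      "j < dim_col (Matrix.mat (2 * N) (2 * N) (\<lambda>(i, j). quat_row (\<lambda>i. complex_row (Y (Suc i))) i j))"
    then have ij: "i < 2 * N" "j < 2 * N" by auto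
    \<comment> \<open>\<open>k\<close> is the first of the four real coordinates of the quaternion
      at column \<open>j\<close>; in \<open>complex_row\<close> it occupies the entries
      \<open>2 * (j div 2)\<close> and \<open>2 * (j div 2) + 1\<close>.\<close>
    define k where "k = 4 * (j div 2)"
    have mod: "i mod 2 = (if even i then 0 else 1)" "j mod 2 = (if even j then 0 else 1)"
      by (simp_all add: even_iff_mod_2_eq_zero)
    have entry: "quaternion_matrix N Y $$ (i, j) =
        quaternion_block (Complex (Y (Suc (i div 2)) k) (Y (Suc (i div 2)) (k + 1)))
          (Complex (Y (Suc (i div 2)) (k + 2)) (Y (Suc (i div 2)) (k + 3))) (i mod 2) (j mod 2)"
      using ij by (simp add: quaternion_matrix_def k_def Let_def)
    have "quaternion_matrix N Y $$ (i, j) = quat_row (\<lambda>i. complex_row (Y (Suc i))) i j"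
    proof (cases "even j")
      case True
      then obtain b where b: "j = 2 * b" by (elim evenE)
      have "2 * j = k" "2 * (j + 1) = k + 2" "k + 2 + 1 = k + 3"
        by (simp_all add: k_def b)
      then show ?thesis
        using True unfolding entry mod
        by (cases "even i") (simp_all only: quaternion_block_def quat_row_def quat_j_def complex_row_def if_True if_False one_neq_zero simp_thms)
    next
      case False
      then obtain b where b: "j = 2 * b + 1" by (elim oddE)
      have "2 * j = k + 2" "2 * (j - 1) = k" "k + 2 + 1 = k + 3"
        by (simp_all add: k_def b)
      then show ?thesis
        using False unfolding entry mod
        by (cases "even i") (simp_all only: quaternion_block_def quat_row_def quat_j_def complex_row_def if_True if_False one_neq_zero simp_thms)
    qed
    then show "quaternion_matrix N Y $$ (i, j) =
        Matrix.mat (2 * N) (2 * N) (\<lambda>(i, j). quat_row (\<lambda>i. complex_row (Y (Suc i))) i j) $$ (i, j)"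
      using ij by simp
  qed (auto simp: quaternion_matrix_def)
  then have 3: "gram_det (quaternion_matrix N Y) = of_real ((cmod (Determinant.det
      (Matrix.mat (2 * N) (2 * N) (\<lambda>(i, j). quat_row (\<lambda>i. complex_row (Y (Suc i))) i j))))\<^sup>2)"
    by (metis gram_det_complex mat_carrier)
  show ?thesis
    by (simp add: abs_det_def sq_det_def 1 2 3 Re_complex_of_real del: of_real_power)
qed

section \<open>Dependence on the first rows, and measurability\<close>

lemma sq_det_cong:
  assumes "\<And>i. i < N \<Longrightarrow> Y i = Y' i"
  shows "sq_det \<beta> N Y = sq_det \<beta> N Y'"
proof -
  have "Matrix.mat N N (\<lambda>(i, j). complex_of_real (Y i j)) = Matrix.mat N N (\<lambda>(i, j). complex_of_real (Y' i j))"
    "Matrix.mat N N (\<lambda>(i, j). complex_row (Y i) j) = Matrix.mat N N (\<lambda>(i, j). complex_row (Y' i) j)"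
    by (auto intro!: eq_matI simp: assms)
  moreover have "Matrix.mat (2 * N) (2 * N) (\<lambda>(i, j). quat_row (\<lambda>i. complex_row (Y i)) i j) =
      Matrix.mat (2 * N) (2 * N) (\<lambda>(i, j). quat_row (\<lambda>i. complex_row (Y' i)) i j)"
    by (intro eq_matI) (auto simp: quat_row_def assms)
  ultimately show ?thesis by (simp only: sq_det_def)
qed

text \<open>By the Leibniz formula the determinant is a polynomial in the entries.\<close>

lemma measurable_det:
  fixes f :: "'x \<Rightarrow> nat \<Rightarrow> nat \<Rightarrow> complex"
  assumes "\<And>i j. i < m \<Longrightarrow> j < m \<Longrightarrow> (\<lambda>x. f x i j) \<in> borel_measurable M"
  shows "(\<lambda>x. Determinant.det (Matrix.mat m m (\<lambda>(i, j). f x i j))) \<in> borel_measurable M"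
proof -
  have "(\<lambda>x. \<Sum>p\<in>{p. p permutes {0..<m}}. signof p * (\<Prod>i = 0..<m. f x i (p i))) \<in> borel_measurable M"
    using assms permutes_in_image
    by (intro borel_measurable_sum borel_measurable_times borel_measurable_prod borel_measurable_const) fastforce
  also have "(\<lambda>x. \<Sum>p\<in>{p. p permutes {0..<m}}. signof p * (\<Prod>i = 0..<m. f x i (p i))) =
      (\<lambda>x. Determinant.det (Matrix.mat m m (\<lambda>(i, j). f x i j)))"
  proof
    fix x
    have "f x i (p i) = Matrix.mat m m (\<lambda>(i, j). f x i j) $$ (i, p i)"
      if "p permutes {0..<m}" "i \<in> {0..<m}" for p i
      using that permutes_in_image[OF that(1), of i] by simp
    then show "(\<Sum>p\<in>{p. p permutes {0..<m}}. signof p * (\<Prod>i = 0..<m. f x i (p i))) =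
        Determinant.det (Matrix.mat m m (\<lambda>(i, j). f x i j))"
      by (subst det_def'[of _ m]) (auto intro!: sum.cong prod.cong)
  qed
  finally show ?thesis .
qed

lemma measurable_sq_det:
  assumes "\<beta> \<in> {1, 2, 4}"
  shows "sq_det \<beta> N \<in> borel_measurable (\<Pi>\<^sub>M i\<in>{..<N}. lebesgue_power (\<beta> * N))"
proof -
  let ?P = "\<Pi>\<^sub>M i\<in>{..<N}. lebesgue_power (\<beta> * N)"
  have coord: "(\<lambda>Y. Y i k) \<in> borel_measurable ?P" if "i < N" "k < \<beta> * N" for i k
    by (rule measurable_compose[OF measurable_component_singleton[of i "{..<N}" "\<lambda>_. lebesgue_power (\<beta> * N)"]
          measurable_coord]) (use that in auto)
  have complex_row: "(\<lambda>Y. complex_row (Y i) j) \<in> borel_measurable ?P" if "i < N" "2 * j + 1 < \<beta> * N" for i j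
    using coord[of i "2 * j"] coord[of i "2 * j + 1"] that
    by (subst borel_measurable_complex_iff) (simp add: complex_row_def)
  have quat: "(\<lambda>Y. quat_row (\<lambda>i. complex_row (Y i)) i j) \<in> borel_measurable ?P"
    if "\<beta> = 4" "i < 2 * N" "j < 2 * N" for i j
  proof -
    have ij: "i div 2 < N" "even j \<Longrightarrow> j + 1 < 2 * N"
      using that by (auto elim!: evenE)
    have cnj: "(\<lambda>Y. cnj (g Y)) \<in> borel_measurable ?P" if "g \<in> borel_measurable ?P" for g
      using that by (rule borel_measurable_continuous_on[rotated]) (intro continuous_intros)
    consider "even i" | "odd i" "even j" | "odd i" "odd j" by blast
    then show ?thesis
    proof cases
      case 1
      then have "(\<lambda>Y. quat_row (\<lambda>i. complex_row (Y i)) i j) = (\<lambda>Y. complex_row (Y (i div 2)) j)"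
        by (simp only: quat_row_def if_True)
      moreover have "(\<lambda>Y. complex_row (Y (i div 2)) j) \<in> borel_measurable ?P"
        using that ij(1) by (intro complex_row) auto
      ultimately show ?thesis by (simp only:)
    next
      case 2
      then have "(\<lambda>Y. quat_row (\<lambda>i. complex_row (Y i)) i j) = (\<lambda>Y. - cnj (complex_row (Y (i div 2)) (j + 1)))"
        by (simp only: quat_row_def quat_j_def if_True if_False)
      moreover have "(\<lambda>Y. complex_row (Y (i div 2)) (j + 1)) \<in> borel_measurable ?P"
        using that(1) ij(1) ij(2)[OF 2(2)] by (intro complex_row) auto
      ultimately show ?thesis by (simp only: borel_measurable_uminus cnj)
    next
      case 3
      then have "(\<lambda>Y. quat_row (\<lambda>i. complex_row (Y i)) i j) = (\<lambda>Y. cnj (complex_row (Y (i div 2)) (j - 1)))"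
        by (simp only: quat_row_def quat_j_def if_False)
      moreover have "(\<lambda>Y. complex_row (Y (i div 2)) (j - 1)) \<in> borel_measurable ?P"
        using that ij(1) by (intro complex_row) auto
      ultimately show ?thesis by (simp only: cnj)
    qed
  qed
  from assms consider "\<beta> = 1" | "\<beta> = 2" | "\<beta> = 4" by auto
  then show ?thesis
  proof cases
    case 1
    then have [measurable]:
      "(\<lambda>Y. Determinant.det (Matrix.mat N N (\<lambda>(i, j). complex_of_real (Y i j)))) \<in> borel_measurable ?P"
      by (intro measurable_det borel_measurable_of_real coord) auto
    from 1 have "sq_det \<beta> N = (\<lambda>Y. (cmod (Determinant.det (Matrix.mat N N (\<lambda>(i, j). complex_of_real (Y i j)))))\<^sup>2)"
      by (simp add: sq_det_def fun_eq_iff)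
    moreover have "\<dots> \<in> borel_measurable ?P" by measurable
    ultimately show ?thesis by (simp only:)
  next
    case 2
    then have [measurable]:
      "(\<lambda>Y. Determinant.det (Matrix.mat N N (\<lambda>(i, j). complex_row (Y i) j))) \<in> borel_measurable ?P"
      by (intro measurable_det complex_row) auto
    from 2 have "sq_det \<beta> N = (\<lambda>Y. (cmod (Determinant.det (Matrix.mat N N (\<lambda>(i, j). complex_row (Y i) j))))\<^sup>2)"
      by (simp add: sq_det_def fun_eq_iff)
    moreover have "\<dots> \<in> borel_measurable ?P" by measurable
    ultimately show ?thesis by (simp only:)
  next
    case 3
    then have [measurable]: "(\<lambda>Y. Determinant.det (Matrix.mat (2 * N) (2 * N)
        (\<lambda>(i, j). quat_row (\<lambda>i. complex_row (Y i)) i j))) \<in> borel_measurable ?P"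
      by (intro measurable_det quat)
    from 3 have "sq_det \<beta> N = (\<lambda>Y. cmod (Determinant.det (Matrix.mat (2 * N) (2 * N)
        (\<lambda>(i, j). quat_row (\<lambda>i. complex_row (Y i)) i j))))"
      by (simp add: sq_det_def fun_eq_iff)
    moreover have "\<dots> \<in> borel_measurable ?P" by measurable
    ultimately show ?thesis by (simp only:)
  qed
qed

lemma sq_det_step:
  assumes "\<beta> \<in> {1, 2, 4}"
  shows "\<exists>ws. \<forall>Y. Y 0 = y \<longrightarrow> sq_det \<beta> (Suc N) Y = sq_norm_row (\<beta> * Suc N) y *
    sq_det \<beta> N (\<lambda>i. drop_coords \<beta> (\<beta> * N) (fold (reflect (\<beta> * Suc N)) ws (Y (Suc i))))"
proof -
  from assms consider "\<beta> = 1" | "\<beta> = 2" | "\<beta> = 4" by auto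
  then show ?thesis
  proof cases
    case 1
    then show ?thesis using exists_reflections_real[of y N] by (simp add: sq_det_def)
  next
    case 2
    then show ?thesis using exists_reflections_complex[of y N] by (simp add: sq_det_def)
  next
    case 3
    then show ?thesis using exists_reflections_quaternion[of y N] by (simp add: sq_det_def)
  qed
qed

text \<open>The argument common to the three weights. Each supplies its radial profile
  \<open>h\<close>, the moments \<open>\<phi> l\<close> of the last \<open>N - l + 1\<close> entries
  of row \<open>l\<close> for exponents near 0, and their derivatives \<open>D l\<close>. The factor
  \<open>1 / 2\<close> arises because the moments are those of the squared determinant.\<close>

lemma expectation_ln_abs_det:
  fixes M :: "'s measure" and x :: "nat \<Rightarrow> 's \<Rightarrow> nat \<Rightarrow> real" and f :: "nat \<Rightarrow> (nat \<Rightarrow> real) \<Rightarrow> real"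
    and h :: "nat \<Rightarrow> real \<Rightarrow> ennreal" and \<phi> :: "nat \<Rightarrow> real \<Rightarrow> real" and D :: "nat \<Rightarrow> real"
  assumes "prob_space M" and \<beta>: "\<beta> \<in> {1, 2, 4}" and "N \<ge> 1"
    and indep: "prob_space.indep_vars M (\<lambda>_. lebesgue_power (\<beta> * N)) x {1..N}"
    and dist: "\<And>l. l \<in> {1..N} \<Longrightarrow> distributed M (lebesgue_power (\<beta> * N)) (x l) (\<lambda>y. ennreal (f l y))"
    and f: "\<And>l y. ennreal (f l y) = h l (sq_norm_row (\<beta> * N) y)"
    and [measurable]: "\<And>l. h l \<in> borel_measurable borel"
    and "\<epsilon> > 0" and \<phi>_nonneg: "\<And>l p. l \<in> {1..N} \<Longrightarrow> \<bar>p\<bar> < \<epsilon> \<Longrightarrow> \<phi> l p \<ge> 0"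
    and moment: "\<And>l p. l \<in> {1..N} \<Longrightarrow> \<bar>p\<bar> < \<epsilon> \<Longrightarrow>
      (\<integral>\<^sup>+y. ennreal ((\<Sum>k=\<beta> * (l - 1)..<\<beta> * N. (y k)\<^sup>2) powr p) * ennreal (f l y) \<partial>lebesgue_power (\<beta> * N)) =
      ennreal (\<phi> l p)"
    and \<phi>_0: "\<And>l. l \<in> {1..N} \<Longrightarrow> \<phi> l 0 = 1"
    and deriv: "\<And>l. l \<in> {1..N} \<Longrightarrow> (\<phi> l has_real_derivative D l) (at 0)"
  shows "integrable M (\<lambda>s. ln (abs_det \<beta> N (\<lambda>l. x l s))) \<and>
    prob_space.expectation M (\<lambda>s. ln (abs_det \<beta> N (\<lambda>l. x l s))) = 1 / 2 * (\<Sum>l = 1..N. D l)"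
proof -
  interpret prob_space M by fact
  let ?L = "lebesgue_power (\<beta> * N)"
  have x[measurable]: "x l \<in> measurable M ?L" if "l \<in> {1..N}" for l
    using dist[OF that] by (auto simp: distributed_def)
  \<comment> \<open>Outside \<open>{1..N}\<close> the law of row 1 stands in, because
    \<open>nn_integral_radial_rows\<close> asks for a radial law at every index.\<close>
  define \<mu> where "\<mu> = (\<lambda>l. distr M ?L (x (if l \<in> {1..N} then l else 1)))"
  have \<mu>: "\<mu> l = distr M ?L (x l)" "\<mu> l = density ?L (\<lambda>y. ennreal (f l y))" if "l \<in> {1..N}" for l
    using that distributed_distr_eq_density[OF dist[OF that]] by (auto simp: \<mu>_def)
  have rad: "radial (\<beta> * N) (\<mu> l)" for l
  proof -
    define l' where "l' = (if l \<in> {1..N} then l else 1)"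
    have l': "l' \<in> {1..N}" using \<open>N \<ge> 1\<close> by (auto simp: l'_def)
    have eq: "\<mu> l = density ?L (\<lambda>y. h l' (sq_norm_row (\<beta> * N) y))"
      using distributed_distr_eq_density[OF dist[OF l']] by (simp add: \<mu>_def l'_def f)
    have "prob_space (\<mu> l)"
      unfolding \<mu>_def l'_def[symmetric] using l' by (intro prob_space_distr) simp
    then show ?thesis
      unfolding eq by (intro radial_density) measurable
  qed
  define Z where "Z = (\<lambda>s. sq_det \<beta> N (\<lambda>i. x (i + 1) s))"
  have Z_nonneg: "Z s \<ge> 0" for s by (simp add: Z_def sq_det_def)
  have x': "(\<lambda>s. \<lambda>l\<in>{1..N}. x l s) \<in> measurable M (\<Pi>\<^sub>M l\<in>{1..N}. ?L)"
    by (intro measurable_restrict x)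
  have meas: "(\<lambda>Y. sq_det \<beta> N (\<lambda>i. Y (i + 1))) \<in> borel_measurable (\<Pi>\<^sub>M l\<in>{1..N}. ?L)"
  proof -
    have "(\<lambda>Y. \<lambda>i\<in>{..<N}. Y (i + 1)) \<in> measurable (\<Pi>\<^sub>M l\<in>{1..N}. ?L) (\<Pi>\<^sub>M i\<in>{..<N}. ?L)"
      by (intro measurable_restrict) auto
    from measurable_compose[OF this measurable_sq_det[OF \<beta>]]
    have "(\<lambda>Y. sq_det \<beta> N (\<lambda>i\<in>{..<N}. Y (i + 1))) \<in> borel_measurable (\<Pi>\<^sub>M l\<in>{1..N}. ?L)" .
    also have "(\<lambda>Y. sq_det \<beta> N (\<lambda>i\<in>{..<N}. Y (i + 1))) = (\<lambda>Y. sq_det \<beta> N (\<lambda>i. Y (i + 1)))"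
      by (intro ext sq_det_cong) simp
    finally show ?thesis .
  qed
  have Z_eq: "Z s = sq_det \<beta> N (\<lambda>i. (\<lambda>l\<in>{1..N}. x l s) (i + 1))" for s
    unfolding Z_def by (rule sq_det_cong) simp
  have Z_meas: "Z \<in> borel_measurable M"
    using measurable_compose[OF x' meas] by (simp add: Z_eq[abs_def])
  have law: "distr M (\<Pi>\<^sub>M l\<in>{1..N}. ?L) (\<lambda>s. \<lambda>l\<in>{1..N}. x l s) = (\<Pi>\<^sub>M l\<in>{1..<1 + N}. \<mu> l)"
  proof -
    have "distr M (\<Pi>\<^sub>M l\<in>{1..N}. ?L) (\<lambda>s. \<lambda>l\<in>{1..N}. x l s) = (\<Pi>\<^sub>M l\<in>{1..N}. distr M ?L (x l))"
      using indep \<open>N \<ge> 1\<close> x by (subst (asm) indep_vars_iff_distr_eq_PiM') auto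
    also have "\<dots> = (\<Pi>\<^sub>M l\<in>{1..N}. \<mu> l)"
      by (intro PiM_cong) (simp_all add: \<mu>)
    finally show ?thesis by (simp add: atLeastLessThanSuc_atLeastAtMost)
  qed
  define \<Phi> where "\<Phi> = (\<lambda>p. \<Prod>i<N. \<phi> (i + 1) p)"
  have mom: "(\<integral>\<^sup>+s. ennreal (Z s powr p) \<partial>M) = ennreal (\<Phi> p)" if p: "\<bar>p\<bar> < \<epsilon>" for p
  proof -
    have "(\<integral>\<^sup>+s. ennreal (Z s powr p) \<partial>M) =
        (\<integral>\<^sup>+Y. ennreal (sq_det \<beta> N (\<lambda>i. Y (i + 1)) powr p) \<partial>distr M (\<Pi>\<^sub>M l\<in>{1..N}. ?L) (\<lambda>s. \<lambda>l\<in>{1..N}. x l s))"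
      using x' meas unfolding Z_eq by (subst nn_integral_distr) auto
    also have "\<dots> = (\<integral>\<^sup>+Y. ennreal (sq_det \<beta> N (\<lambda>i. Y (i + 1)) powr p) \<partial>(\<Pi>\<^sub>M l\<in>{1..<1 + N}. \<mu> l))"
      by (simp only: law)
    also have "\<dots> = (\<Prod>i<N. \<integral>\<^sup>+y. ennreal ((\<Sum>j=\<beta> * i..<\<beta> * N. (y j)\<^sup>2) powr p) \<partial>\<mu> (i + 1))"
    proof (rule nn_integral_radial_rows)
      show "sq_det \<beta> 0 Y = 1" for Y by (simp add: sq_det_def)
      show "sq_det \<beta> N Y \<ge> 0" for N Y by (simp add: sq_det_def)
    qed (fact sq_det_cong measurable_sq_det[OF \<beta>] sq_det_step[OF \<beta>] rad)+
    also have "\<dots> = (\<Prod>i<N. ennreal (\<phi> (i + 1) p))"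
    proof (rule prod.cong)
      fix i assume "i \<in> {..<N}"
      then have l: "i + 1 \<in> {1..N}" by auto
      have [measurable]: "(\<lambda>y. ennreal (f (i + 1) y)) \<in> borel_measurable ?L"
        using dist[OF l] by (simp add: distributed_def)
      have [measurable]: "(\<lambda>y. \<Sum>j=\<beta> * i..<\<beta> * N. (y j)\<^sup>2) \<in> borel_measurable ?L"
        by (rule borel_measurable_sum) auto
      have "(\<integral>\<^sup>+y. ennreal ((\<Sum>j=\<beta> * i..<\<beta> * N. (y j)\<^sup>2) powr p) \<partial>\<mu> (i + 1)) =
          (\<integral>\<^sup>+y. ennreal (f (i + 1) y) * ennreal ((\<Sum>j=\<beta> * i..<\<beta> * N. (y j)\<^sup>2) powr p) \<partial>?L)"
        unfolding \<mu>(2)[OF l] by (rule nn_integral_density) measurable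
      then show "(\<integral>\<^sup>+y. ennreal ((\<Sum>j=\<beta> * i..<\<beta> * N. (y j)\<^sup>2) powr p) \<partial>\<mu> (i + 1)) = ennreal (\<phi> (i + 1) p)"
        using moment[OF l p] by (simp add: mult.commute)
    qed simp
    also have "\<dots> = ennreal (\<Phi> p)"
      unfolding \<Phi>_def using \<phi>_nonneg p by (intro prod_ennreal) auto
    finally show ?thesis .
  qed
  \<comment> \<open>All factors are 1 at exponent 0, so the product rule reduces to the sum of the
    derivatives.\<close>
  have "(\<Phi> has_real_derivative (\<Sum>i<N. D (i + 1))) (at 0)"
  proof -
    have "((\<lambda>p. \<Prod>i<N. \<phi> (i + 1) p) has_real_derivative
        (\<Sum>i<N. D (i + 1) * (\<Prod>j\<in>{..<N} - {i}. \<phi> (j + 1) 0))) (at 0)"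
      by (rule has_field_derivative_prod) (auto intro: deriv)
    moreover have "(\<Prod>j\<in>{..<N} - {i}. \<phi> (j + 1) 0) = 1" for i
      by (rule prod.neutral) (auto simp: \<phi>_0)
    ultimately show ?thesis by (simp add: \<Phi>_def)
  qed
  moreover have "\<Phi> p \<ge> 0" if "\<bar>p\<bar> < \<epsilon>" for p
    unfolding \<Phi>_def using \<phi>_nonneg that by (intro prod_nonneg) auto
  ultimately have "integrable M (\<lambda>s. ln (Z s))" "expectation (\<lambda>s. ln (Z s)) = (\<Sum>i<N. D (i + 1))"
    using expectation_ln_of_moments[OF Z_meas Z_nonneg \<open>\<epsilon> > 0\<close> _ mom] by blast+
  \<comment> \<open>Also true for a singular matrix, since \<open>ln 0\<close> is
    \<open>0\<close>.\<close>
  moreover have "ln (abs_det \<beta> N (\<lambda>l. x l s)) = 1 / 2 * ln (Z s)" for s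
    using Z_nonneg[of s] by (cases "Z s = 0") (simp_all add: abs_det_eq Z_def ln_sqrt)
  then have "(\<lambda>s. ln (abs_det \<beta> N (\<lambda>l. x l s))) = (\<lambda>s. 1 / 2 * ln (Z s))" by blast
  moreover have "(\<Sum>i<N. D (i + 1)) = (\<Sum>l = 1..N. D l)"
    using sum.shift_bounds_Suc_ivl[of D 0 N]
    by (simp add: atLeast0LessThan atLeastLessThanSuc_atLeastAtMost)
  ultimately show ?thesis by (simp only:) simp
qed

text \<open>The bound \<open>1 / 2\<close> is attained by the last row for
  \<open>\<beta> = 1\<close>. It lets one range of exponents, \<open>\<bar>p\<bar> < 1 / 2\<close>,
  keep the Gamma arguments of all tails positive.\<close>

lemma tail_dimension:
  assumes "\<beta> \<in> {1, 2, 4 :: nat}" "l \<in> {1..N}"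
  shows "real (\<beta> * N - \<beta> * (l - 1)) / 2 = real \<beta> * real (N - l + 1) / 2"
    "\<beta> * (l - 1) < \<beta> * N" "real \<beta> * real (N - l + 1) / 2 \<ge> 1 / 2"
proof -
  have "\<beta> * N - \<beta> * (l - 1) = \<beta> * (N - l + 1)"
    using assms(2) by (simp add: diff_mult_distrib2[symmetric] Suc_diff_le)
  then show "real (\<beta> * N - \<beta> * (l - 1)) / 2 = real \<beta> * real (N - l + 1) / 2"
    by (metis of_nat_mult)
  show "\<beta> * (l - 1) < \<beta> * N" using assms by auto
  have "1 * 1 \<le> real \<beta> * real (N - l + 1)"
    using assms by (intro mult_mono) auto
  then show "real \<beta> * real (N - l + 1) / 2 \<ge> 1 / 2" by simp
qed

theorem corollary5:
  fixes M :: "'s measure"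
    and \<beta> N :: nat
    and x :: "nat \<Rightarrow> 's \<Rightarrow> nat \<Rightarrow> real"
    and \<sigma> \<nu> \<omega> :: "nat \<Rightarrow> real"
  assumes "prob_space M"
    and "\<beta> \<in> {1, 2, 4}"
    and "N \<ge> 1"
    and "prob_space.indep_vars M (\<lambda>_. lebesgue_power (\<beta> * N)) x {1..N}"
  shows
    "((\<forall>l\<in>{1..N}. \<sigma> l > 0 \<and>
        distributed M (lebesgue_power (\<beta> * N)) (x l) (\<lambda>y. ennreal (gaussian_density \<beta> N (\<sigma> l) y)))
     \<longrightarrow> integrable M (\<lambda>s. ln (abs_det \<beta> N (\<lambda>l. x l s))) \<and>
         prob_space.expectation M (\<lambda>s. ln (abs_det \<beta> N (\<lambda>l. x l s))) =
           1 / 2 * (\<Sum>l = 1..N. ln (2 * (\<sigma> l)\<^sup>2) + Digamma (real \<beta> * real (N - l + 1) / 2)))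
    \<and>
    ((\<forall>l\<in>{1..N}. \<nu> l > 0 \<and>
        distributed M (lebesgue_power (\<beta> * N)) (x l) (\<lambda>y. ennreal (beta1_density \<beta> N (\<nu> l) y)))
     \<longrightarrow> integrable M (\<lambda>s. ln (abs_det \<beta> N (\<lambda>l. x l s))) \<and>
         prob_space.expectation M (\<lambda>s. ln (abs_det \<beta> N (\<lambda>l. x l s))) =
           1 / 2 * (\<Sum>l = 1..N. Digamma (real \<beta> * real (N - l + 1) / 2)
                              - Digamma (real \<beta> * (real N + \<nu> l) / 2)))
    \<and>
    ((\<forall>l\<in>{1..N}. \<omega> l > 0 \<and>
        distributed M (lebesgue_power (\<beta> * N)) (x l) (\<lambda>y. ennreal (beta2_density \<beta> N (\<omega> l) y)))
     \<longrightarrow> integrable M (\<lambda>s. ln (abs_det \<beta> N (\<lambda>l. x l s))) \<and>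
         prob_space.expectation M (\<lambda>s. ln (abs_det \<beta> N (\<lambda>l. x l s))) =
           1 / 2 * (\<Sum>l = 1..N. Digamma (real \<beta> * real (N - l + 1) / 2)
                              - Digamma (\<omega> l / 2)))"
proof (intro conjI[of "_ \<longrightarrow> _"] impI)
  let ?a = "\<lambda>l. real \<beta> * real (N - l + 1) / 2"
  note tail = tail_dimension[OF assms(2)]
  have pos: "Gamma (?a l + p) > 0" "Gamma (?a l) > 0" if "l \<in> {1..N}" "\<bar>p\<bar> < 1 / 2" for l p
    using tail(3)[OF that(1)] that(2) by (auto intro!: Gamma_real_pos)
  {
    assume A: "\<forall>l\<in>{1..N}. \<sigma> l > 0 \<and>
      distributed M (lebesgue_power (\<beta> * N)) (x l) (\<lambda>y. ennreal (gaussian_density \<beta> N (\<sigma> l) y))"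
    let ?h = "\<lambda>l t. ennreal ((2 * pi * (\<sigma> l)\<^sup>2) powr (- (real \<beta> * real N / 2)) * exp (- t / (2 * (\<sigma> l)\<^sup>2)))"
    let ?\<phi> = "\<lambda>l p. (2 * (\<sigma> l)\<^sup>2) powr p * (Gamma (?a l + p) / Gamma (?a l))"
    show "integrable M (\<lambda>s. ln (abs_det \<beta> N (\<lambda>l. x l s))) \<and>
      prob_space.expectation M (\<lambda>s. ln (abs_det \<beta> N (\<lambda>l. x l s))) =
        1 / 2 * (\<Sum>l = 1..N. ln (2 * (\<sigma> l)\<^sup>2) + Digamma (?a l))"
    proof (rule expectation_ln_abs_det[OF assms, where h = ?h and \<phi> = ?\<phi> and \<epsilon> = "1 / 2"
          and f = "\<lambda>l. gaussian_density \<beta> N (\<sigma> l)"])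
      fix l assume l: "l \<in> {1..N}"
      note t = tail[OF l]
      have "\<sigma> l > 0" using A l by blast
      then have \<sigma>: "\<sigma> l > 0" "2 * (\<sigma> l)\<^sup>2 > 0" by simp_all
      show "?\<phi> l 0 = 1" using pos[OF l, of 0] \<sigma> by simp
      show "(?\<phi> l has_real_derivative ln (2 * (\<sigma> l)\<^sup>2) + Digamma (?a l)) (at 0)"
      proof -
        have "((\<lambda>p. (2 * (\<sigma> l)\<^sup>2) powr p) has_real_derivative ln (2 * (\<sigma> l)\<^sup>2)) (at 0)"
          using \<sigma> by (auto intro!: derivative_eq_intros)
        moreover have "((\<lambda>p. Gamma (?a l + p) / Gamma (?a l)) has_real_derivative Digamma (?a l)) (at 0)"
          using t(3) by (intro Gamma_ratio_derivative) simp
        ultimately show ?thesis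
          using DERIV_mult[of "\<lambda>p. (2 * (\<sigma> l)\<^sup>2) powr p" _ 0 UNIV] pos[OF l, of 0] \<sigma> by fastforce
      qed
      fix p :: real assume p: "\<bar>p\<bar> < 1 / 2"
      show "?\<phi> l p \<ge> 0" using pos[OF l p] by simp
      show "(\<integral>\<^sup>+y. ennreal ((\<Sum>k=\<beta> * (l - 1)..<\<beta> * N. (y k)\<^sup>2) powr p) *
          ennreal (gaussian_density \<beta> N (\<sigma> l) y) \<partial>lebesgue_power (\<beta> * N)) = ennreal (?\<phi> l p)"
        using gaussian_tail_moment[of "\<beta> * (l - 1)" \<beta> N "\<sigma> l" p, unfolded t(1)] t \<sigma> p by auto
    qed (use A in \<open>auto simp: gaussian_density_def\<close>)
  next
    assume A: "\<forall>l\<in>{1..N}. \<nu> l > 0 \<and>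
      distributed M (lebesgue_power (\<beta> * N)) (x l) (\<lambda>y. ennreal (beta1_density \<beta> N (\<nu> l) y))"
    let ?c = "\<lambda>l. real \<beta> * (real N + \<nu> l) / 2"
    let ?h = "\<lambda>l t. ennreal (if t < 1 then pi powr (- (real \<beta> * real N / 2)) *
      gen_pochhammer (real \<beta> * \<nu> l / 2) (real \<beta> * real N / 2) * (1 - t) powr (real \<beta> * \<nu> l / 2 - 1) else 0)"
    let ?\<phi> = "\<lambda>l p. Gamma (?a l + p) / Gamma (?a l) * (Gamma (?c l) / Gamma (?c l + p))"
    show "integrable M (\<lambda>s. ln (abs_det \<beta> N (\<lambda>l. x l s))) \<and>
      prob_space.expectation M (\<lambda>s. ln (abs_det \<beta> N (\<lambda>l. x l s))) =
        1 / 2 * (\<Sum>l = 1..N. Digamma (?a l) - Digamma (?c l))"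
    proof (rule expectation_ln_abs_det[OF assms, where h = ?h and \<phi> = ?\<phi> and \<epsilon> = "1 / 2"
          and f = "\<lambda>l. beta1_density \<beta> N (\<nu> l)"])
      fix l assume l: "l \<in> {1..N}"
      note t = tail[OF l]
      have \<nu>: "\<nu> l > 0" using A l by auto
      \<comment> \<open>\<open>\<beta> \<ge> 1\<close> and \<open>N \<ge> 1\<close> place the second
        Gamma argument at \<open>1 / 2\<close> or above, so the same range of exponents serves for
        it.\<close>
      have "1 * (1 + 0) \<le> real \<beta> * (real N + \<nu> l)"
        using \<nu> assms(2,3) by (intro mult_mono add_mono) auto
      then have c: "?c l \<ge> 1 / 2" by simp
      have posc: "Gamma (?c l + p) > 0" if "\<bar>p\<bar> < 1 / 2" for p
        using c that by (intro Gamma_real_pos) linarith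
      show "?\<phi> l 0 = 1" using pos[OF l, of 0] posc[of 0] by simp
      show "(?\<phi> l has_real_derivative Digamma (?a l) - Digamma (?c l)) (at 0)"
      proof -
        have "((\<lambda>p. Gamma (?a l + p) / Gamma (?a l)) has_real_derivative Digamma (?a l)) (at 0)"
          using t(3) by (intro Gamma_ratio_derivative) simp
        moreover have "((\<lambda>p. Gamma (?c l) / Gamma (?c l + p)) has_real_derivative - Digamma (?c l)) (at 0)"
          using c by (intro Gamma_ratio_derivative) simp
        ultimately show ?thesis
          using DERIV_mult[of "\<lambda>p. Gamma (?a l + p) / Gamma (?a l)" _ 0 UNIV] pos[OF l, of 0] posc[of 0] by fastforce
      qed
      fix p :: real assume p: "\<bar>p\<bar> < 1 / 2"
      show "?\<phi> l p \<ge> 0" using pos[OF l p] posc[OF p] posc[of 0] by simp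
      show "(\<integral>\<^sup>+y. ennreal ((\<Sum>k=\<beta> * (l - 1)..<\<beta> * N. (y k)\<^sup>2) powr p) *
          ennreal (beta1_density \<beta> N (\<nu> l) y) \<partial>lebesgue_power (\<beta> * N)) = ennreal (?\<phi> l p)"
        using beta1_tail_moment[of "\<beta> * (l - 1)" \<beta> N "\<nu> l" p, unfolded t(1)] t \<nu> p by auto
    qed (use A in \<open>auto simp: beta1_density_def\<close>)
  next
    assume A: "\<forall>l\<in>{1..N}. \<omega> l > 0 \<and>
      distributed M (lebesgue_power (\<beta> * N)) (x l) (\<lambda>y. ennreal (beta2_density \<beta> N (\<omega> l) y))"
    let ?c = "\<lambda>l. \<omega> l / 2"
    let ?h = "\<lambda>l t. ennreal (pi powr (- (real \<beta> * real N / 2)) *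
      gen_pochhammer (\<omega> l / 2) (real \<beta> * real N / 2) * (1 + t) powr (- (real \<beta> * real N + \<omega> l) / 2))"
    let ?\<phi> = "\<lambda>l p. Gamma (?a l + p) / Gamma (?a l) * (Gamma (?c l - p) / Gamma (?c l))"
    \<comment> \<open>This weight has heavy tails: row \<open>l\<close> has moments only for
      exponents below \<open>\<omega> l / 2\<close>, so the range shrinks to the smallest of these
      bounds.\<close>
    define \<epsilon> where "\<epsilon> = Min (insert (1 / 2) (?c ` {1..N}))"
    have \<epsilon>: "\<epsilon> > 0" using A by (auto simp: \<epsilon>_def)
    have \<epsilon>_le: "\<epsilon> \<le> 1 / 2" "l \<in> {1..N} \<Longrightarrow> \<epsilon> \<le> ?c l" for l
      unfolding \<epsilon>_def by (rule Min_le, simp, blast)+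
    show "integrable M (\<lambda>s. ln (abs_det \<beta> N (\<lambda>l. x l s))) \<and>
      prob_space.expectation M (\<lambda>s. ln (abs_det \<beta> N (\<lambda>l. x l s))) =
        1 / 2 * (\<Sum>l = 1..N. Digamma (?a l) - Digamma (?c l))"
    proof (rule expectation_ln_abs_det[OF assms, where h = ?h and \<phi> = ?\<phi> and \<epsilon> = \<epsilon>
          and f = "\<lambda>l. beta2_density \<beta> N (\<omega> l)"])
      fix l assume l: "l \<in> {1..N}"
      note t = tail[OF l]
      have \<omega>: "\<omega> l > 0" using A l by auto
      have posc: "Gamma (?c l - p) > 0" if "\<bar>p\<bar> < \<epsilon>" for p
        using \<epsilon>_le(2)[OF l] that by (intro Gamma_real_pos) linarith
      show "?\<phi> l 0 = 1" using pos[OF l, of 0] posc[of 0] \<epsilon> by simp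
      show "(?\<phi> l has_real_derivative Digamma (?a l) - Digamma (?c l)) (at 0)"
      proof -
        have "((\<lambda>p. Gamma (?a l + p) / Gamma (?a l)) has_real_derivative Digamma (?a l)) (at 0)"
          using t(3) by (intro Gamma_ratio_derivative) simp
        moreover have "((\<lambda>p. Gamma (?c l - p) / Gamma (?c l)) has_real_derivative - Digamma (?c l)) (at 0)"
          using \<omega> by (intro Gamma_ratio_derivative) simp
        ultimately show ?thesis
          using DERIV_mult[of "\<lambda>p. Gamma (?a l + p) / Gamma (?a l)" _ 0 UNIV] pos[OF l, of 0] posc[of 0] \<epsilon> by fastforce
      qed
      fix p :: real assume p: "\<bar>p\<bar> < \<epsilon>"
      then have p': "\<bar>p\<bar> < 1 / 2" "p < \<omega> l / 2" using \<epsilon>_le(1) \<epsilon>_le(2)[OF l] by linarith+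
      show "?\<phi> l p \<ge> 0" using pos[OF l p'(1)] posc[OF p] posc[of 0] \<epsilon> by simp
      show "(\<integral>\<^sup>+y. ennreal ((\<Sum>k=\<beta> * (l - 1)..<\<beta> * N. (y k)\<^sup>2) powr p) *
          ennreal (beta2_density \<beta> N (\<omega> l) y) \<partial>lebesgue_power (\<beta> * N)) = ennreal (?\<phi> l p)"
        using beta2_tail_moment[of "\<beta> * (l - 1)" \<beta> N "\<omega> l" p, unfolded t(1)] t \<omega> p' by auto
    qed (use A \<epsilon> in \<open>auto simp: beta2_density_def\<close>)
  }
qed

end
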